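(* Let $\omega_f,\omega_v>0$, $k_P,k_Q\ge0$, $\sigma>0$, let $$\mathbf{A}_\perp=\begin{pmatrix}-\omega_f & k_P\omega_f\\ -k_Q\omega_v & -\omega_v\end{pmatrix},$$ and consider the Ornstein--Uhlenbeck process $d\boldsymbol{\xi}_\perp=\mathbf{A}_\perp\boldsymbol{\xi}_\perp\,dt+\sigma\,dW_t$ in $\mathbb{R}^2$, with stable drift $\mathbf{A}_\perp$. It has two distinct covariance matrices. (a) Instantaneous covariance $\boldsymbol{\Sigma}$: the unique symmetric positive-definite solution of $$\mathbf{A}_\perp\boldsymbol{\Sigma}+\boldsymbol{\Sigma}\mathbf{A}_\perp^\top+\sigma^2I_2=0.$$ With $s=\omega_f+\omega_v$ and $\Delta=\omega_f\omega_v(1+k_Pk_Q)$, solving the equivalent $3\times3$ linear system for the entries of $\boldsymbol{\Sigma}$ gives $$\boldsymbol{\Sigma}=\frac{\sigma^2}{2\Delta s}\begin{pmatrix}\omega_v s+k_P^2\omega_f^2+k_Pk_Q\omega_f\omega_v & k_P\omega_f^2-k_Q\omega_v^2\\ k_P\omega_f^2-k_Q\omega_v^2 & \omega_f s+k_Q^2\omega_v^2+k_Pk_Q\omega_f\omega_v\end{pmatrix}.$$ The off-diagonal entry $\boldsymbol{\Sigma}_{12}=\sigma^2(k_P\omega_f^2-k_Q\omega_v^2)/(2\Delta s)$ is negative for the baseline parameters ($k_P=k_Q$, $\omega_v>\omega_f$). At $k_P=k_Q=0$: $\boldsymbol{\Sigma}=\frac{\sigma^2}{2}\,\mathrm{diag}(\omega_f^{-1},\omega_v^{-1})$.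 (b) Long-run covariance $\boldsymbol{\Sigma}_{\mathrm{long}}$: the integral of the autocovariance function of $\boldsymbol{\xi}_\perp$, $$\boldsymbol{\Sigma}_{\mathrm{long}}:=\int_{-\infty}^{\infty}\mathrm{Cov}(\boldsymbol{\xi}_\perp(0),\boldsymbol{\xi}_\perp(\tau))\,d\tau=(-\mathbf{A}_\perp)^{-1}\boldsymbol{\Sigma}+\boldsymbol{\Sigma}(-\mathbf{A}_\perp)^{-\top}.$$ For $k_Pk_Q\ll1$ (leading order in droop coupling): $$\boldsymbol{\Sigma}_{\mathrm{long}}\approx\sigma^2\,\mathrm{diag}\!\left(\frac1{\omega_f^2},\frac1{\omega_v^2}\right),\qquad \boldsymbol{\Sigma}_{\mathrm{long}}^{-1}\approx\frac1{\sigma^2}\,\mathrm{diag}(\omega_f^2,\omega_v^2).$$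
   Context: $W_t$ is a standard 2-dimensional Brownian motion. The drift matrix $\mathbf{A}_\perp$ is Hurwitz (all eigenvalues have negative real part), so the process is ergodic with unique stationary distribution $\mathcal{N}(\mathbf{0},\boldsymbol{\Sigma})$; the autocovariance in (b) is that of the stationary process. $M^{-\top}$ denotes $(M^{-1})^\top$. Here $\boldsymbol{\xi}_\perp=(\delta\omega,\delta V)^\top$ is the vector of frequency and voltage deviations of a grid-forming inverter, $\omega_f,\omega_v$ are filter bandwidths, $k_P,k_Q$ are droop gains ("droop coupling" refers to these), and $\sigma$ is the noise intensity. The baseline parameters are $\omega_f=10$ rad/s, $\omega_v=20$ rad/s, $k_P=k_Q=0.05$, $\sigma=0.02$.
   Formalization: "Two distinct covariance matrices" is claimed except when ωf=ωv, kP=kQ and ωf(1+kP²)=2, where the two coincide; "kPkQ≪1" is read as both gains tending to 0 with O(|(kP,kQ)|) error, since a small product alone (kQ=0, kP=1) does not make Σ_long nearly diagonal. *)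

theory Defs
  imports "HOL-Probability.Probability"
begin

definition hurwitz :: "real^'n^'n \<Rightarrow> bool" where
  "hurwitz A \<longleftrightarrow>
     (\<forall>(l::complex) (v::complex^'n).
        v \<noteq> 0 \<and> map_matrix complex_of_real A *v v = l *s v \<longrightarrow> Re l < 0)"

definition sym_pos_def :: "real^'n^'n \<Rightarrow> bool" where
  "sym_pos_def S \<longleftrightarrow> transpose S = S \<and> (\<forall>x. x \<noteq> 0 \<longrightarrow> x \<bullet> (S *v x) > 0)"

definition lyapunov :: "real^'n^'n \<Rightarrow> real \<Rightarrow> real^'n^'n \<Rightarrow> bool" where
  "lyapunov A \<sigma> S \<longleftrightarrow> A ** S + S ** transpose A + \<sigma>\<^sup>2 *\<^sub>R mat 1 = 0"

definition inst_cov :: "real^'n^'n \<Rightarrow> real \<Rightarrow> real^'n^'n" where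
  "inst_cov A \<sigma> = (THE S. sym_pos_def S \<and> lyapunov A \<sigma> S)"

definition matrix2 :: "'a::zero \<Rightarrow> 'a \<Rightarrow> 'a \<Rightarrow> 'a \<Rightarrow> 'a^2^2" where
  "matrix2 a b c d = vector [vector [a, b], vector [c, d]]"

definition drift :: "real \<Rightarrow> real \<Rightarrow> real \<Rightarrow> real \<Rightarrow> real^2^2" where
  "drift \<omega>f \<omega>v kP kQ = matrix2 (- \<omega>f) (kP * \<omega>f) (- (kQ * \<omega>v)) (- \<omega>v)"

text \<open>
  Time runs over the whole real line, since the long-run covariance integrates the
  autocovariance over all lags. For each \<open>s\<close>, the process \<open>\<lambda>t. W (s + t) - W s\<close> on
  \<open>t \<ge> 0\<close> is a standard Brownian motion independent of \<open>F s\<close>. Only the increments of \<open>W\<close>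
  are adapted: for \<open>t < 0\<close>, the normalisation \<open>W 0 = 0\<close> makes \<open>W t\<close> depend on the
  increment over \<open>[t, 0]\<close>, that is, on the future of \<open>t\<close>.
\<close>
definition brownian_motion ::
  "'a measure \<Rightarrow> (real \<Rightarrow> 'a measure) \<Rightarrow> (real \<Rightarrow> 'a \<Rightarrow> real^'n) \<Rightarrow> bool" where
  "brownian_motion M F W \<longleftrightarrow>
     prob_space M \<and> filtration (space M) F \<and> (\<forall>t. subalgebra M (F t)) \<and>
     (\<forall>s t. s \<le> t \<longrightarrow> (\<lambda>x. W t x - W s x) \<in> borel_measurable (F t)) \<and>
     (AE x in M. W 0 x = 0) \<and>
     (AE x in M. continuous_on UNIV (\<lambda>t. W t x)) \<and>
     (\<forall>s t. s < t \<longrightarrow>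
        (\<forall>i. distributed M lborel (\<lambda>x. (W t x - W s x) $ i) (normal_density 0 (sqrt (t - s)))) \<and>
        prob_space.indep_vars M (\<lambda>_. borel) (\<lambda>i x. (W t x - W s x) $ i) UNIV \<and>
        prob_space.indep_set M (sets (F s))
          {(\<lambda>x. W t x - W s x) -` B \<inter> space M | B. B \<in> sets borel})"

text \<open>
  Since the noise is additive, the stochastic integral of the constant \<open>\<sigma>\<close> over \<open>[s, t]\<close> is
  \<open>\<sigma> (W t - W s)\<close>, so the integrated form of \<open>d\<xi> = A \<xi> dt + \<sigma> dW\<close> makes sense path by path.
\<close>
definition ou_process ::
  "'a measure \<Rightarrow> (real \<Rightarrow> 'a measure) \<Rightarrow> (real \<Rightarrow> 'a \<Rightarrow> real^'n) \<Rightarrow> real^'n^'n \<Rightarrow> real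
     \<Rightarrow> (real \<Rightarrow> 'a \<Rightarrow> real^'n) \<Rightarrow> bool" where
  "ou_process M F W A \<sigma> \<xi> \<longleftrightarrow>
     brownian_motion M F W \<and>
     (\<forall>t. \<xi> t \<in> borel_measurable (F t)) \<and>
     (AE x in M. continuous_on UNIV (\<lambda>t. \<xi> t x)) \<and>
     (AE x in M. \<forall>s t. s \<le> t \<longrightarrow>
        \<xi> t x - \<xi> s x = integral {s..t} (\<lambda>u. A *v \<xi> u x) + \<sigma> *\<^sub>R (W t x - W s x))"

text \<open>Strict stationarity: the finite-dimensional distributions are invariant under time shifts.\<close>
definition stationary :: "'a measure \<Rightarrow> (real \<Rightarrow> 'a \<Rightarrow> real^'n) \<Rightarrow> bool" where
  "stationary M \<xi> \<longleftrightarrow>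
     (\<forall>T h. finite T \<longrightarrow>
        distr M (PiM T (\<lambda>_. borel)) (\<lambda>x. \<lambda>t\<in>T. \<xi> (t + h) x) =
        distr M (PiM T (\<lambda>_. borel)) (\<lambda>x. \<lambda>t\<in>T. \<xi> t x))"

definition stationary_ou ::
  "'a measure \<Rightarrow> (real \<Rightarrow> 'a measure) \<Rightarrow> (real \<Rightarrow> 'a \<Rightarrow> real^'n) \<Rightarrow> real^'n^'n \<Rightarrow> real
     \<Rightarrow> (real \<Rightarrow> 'a \<Rightarrow> real^'n) \<Rightarrow> bool" where
  "stationary_ou M F W A \<sigma> \<xi> \<longleftrightarrow> ou_process M F W A \<sigma> \<xi> \<and> stationary M \<xi>"

definition square_integrable :: "'a measure \<Rightarrow> ('a \<Rightarrow> real^'n) \<Rightarrow> bool" where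
  "square_integrable M X \<longleftrightarrow> X \<in> borel_measurable M \<and> integrable M (\<lambda>x. (norm (X x))\<^sup>2)"

definition cov :: "'a measure \<Rightarrow> ('a \<Rightarrow> real^'n) \<Rightarrow> ('a \<Rightarrow> real^'n) \<Rightarrow> real^'n^'n" where
  "cov M X Y = (\<chi> i j.
     LINT x|M. (X x $ i - (LINT y|M. X y $ i)) * (Y x $ j - (LINT y|M. Y y $ j)))"

definition long_run_cov :: "'a measure \<Rightarrow> (real \<Rightarrow> 'a \<Rightarrow> real^'n) \<Rightarrow> real^'n^'n" where
  "long_run_cov M \<xi> = (LINT \<tau>|lborel. cov M (\<xi> 0) (\<xi> \<tau>))"

end

theory Submission
  imports Defs
begin

text \<open>
  Let \<open>S\<close> solve the Lyapunov equation, let \<open>E\<close> solve \<open>E' = A\<^sup>T E\<close>, \<open>E 0 = 1\<close>, and let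
  \<open>V y = y \<bullet> S y\<close>. Along \<open>y = E \<eta>\<close> the Lyapunov equation gives \<open>V' = - \<sigma>\<^sup>2 |y|\<^sup>2\<close>, so \<open>E\<close> decays
  exponentially and \<open>V \<eta> - V (E h \<eta>)\<close> is the variance of the noise collected by \<open>\<eta> \<bullet> \<xi>\<close> over a time
  step \<open>h\<close>. Hence the characteristic function of \<open>\<xi> t\<close>, conditional on the past of \<open>s\<close>, is
  \<open>exp (\<i> E (t - s) \<eta> \<bullet> \<xi> s - (V \<eta> - V (E (t - s) \<eta>)) / 2)\<close>. Stationarity and \<open>t - s \<rightarrow> \<infinity>\<close> force
  \<open>\<xi> t\<close> to be centred Gaussian with covariance \<open>S\<close>, without any a priori moment bound, and the joint
  characteristic function then yields \<open>cov (\<xi> s) (\<xi> t) = S E (t - s)\<close>. As \<open>S E\<close> is the derivative of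
  \<open>S (A\<^sup>T)\<inverse> E\<close>, integrating over all lags gives the long-run covariance, which the Lyapunov
  equation turns into \<open>\<sigma>\<^sup>2 A\<inverse> (A\<inverse>)\<^sup>T\<close>.
\<close>

subsection \<open>Linear flow and Lyapunov decay\<close>

lemma norm_matrix_le_sum: "norm (M :: real^'n^'m) \<le> (\<Sum>i\<in>UNIV. \<Sum>j\<in>UNIV. \<bar>M $ i $ j\<bar>)"
proof -
  have "norm M \<le> (\<Sum>i\<in>UNIV. norm (M $ i))"
    unfolding norm_vec_def by (rule L2_set_le_sum) simp
  also have "\<dots> \<le> (\<Sum>i\<in>UNIV. \<Sum>j\<in>UNIV. \<bar>M $ i $ j\<bar>)"
    by (intro sum_mono norm_le_l1_cart)
  finally show ?thesis .
qed

lemma has_vector_derivative_matrixI: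
  fixes f :: "real \<Rightarrow> real^'n^'m"
  assumes "\<And>i j. ((\<lambda>t. f t $ i $ j) has_field_derivative f' $ i $ j) (at t)"
  shows "(f has_vector_derivative f') (at t)"
  unfolding has_vector_derivative_def
proof (subst has_derivative_componentwise_within, rule ballI)
  fix b :: "real^'n^'m"
  assume "b \<in> Basis"
  then obtain i j where b: "b = axis i (axis j 1)"
    by (auto simp: Basis_vec_def)
  have "(\<lambda>x. (x *\<^sub>R f') \<bullet> b) = (*) (f' $ i $ j)"
    by (simp add: fun_eq_iff b inner_axis)
  moreover have "(\<lambda>t. f t \<bullet> b) = (\<lambda>t. f t $ i $ j)"
    by (simp add: fun_eq_iff b inner_axis)
  ultimately show "((\<lambda>t. f t \<bullet> b) has_derivative (\<lambda>x. (x *\<^sub>R f') \<bullet> b)) (at t)"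
    using assms[of i j] unfolding has_field_derivative_def by (simp only:)
qed

text \<open>Each entry of exp (t B) is a real power series in \<open>t\<close>, so existence reduces
  to termwise differentiation of scalar series. The entries of B^n are at most \<open>K ^ n\<close>,
  so every series converges on the whole line.\<close>

lemma exists_matrix_exp:
  fixes B :: "real^'n^'n"
  shows "\<exists>E. E 0 = mat 1 \<and> (\<forall>t. (E has_vector_derivative B ** E t) (at t))"
proof -
  define P where "P n = (((**) B) ^^ n) (mat 1)" for n
  have P0: "P 0 = mat 1" and PS: "P (Suc n) = B ** P n" for n
    by (simp_all add: P_def)
  define K where "K = (\<Sum>i\<in>UNIV. \<Sum>j\<in>UNIV. \<bar>B $ i $ j\<bar>)"
  have K: "(\<Sum>k\<in>UNIV. \<bar>B $ i $ k\<bar>) \<le> K" for i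
    unfolding K_def by (rule member_le_sum[where f="\<lambda>i. \<Sum>k\<in>UNIV. \<bar>B $ i $ k\<bar>"]) (auto intro: sum_nonneg)
  have bound: "\<bar>P n $ i $ j\<bar> \<le> K ^ n" for n i j
  proof (induction n arbitrary: i)
    case 0
    show ?case by (simp add: P0 mat_def)
  next
    case (Suc n)
    have "\<bar>P (Suc n) $ i $ j\<bar> \<le> (\<Sum>k\<in>UNIV. \<bar>B $ i $ k * P n $ k $ j\<bar>)"
      unfolding PS matrix_matrix_mult_def by simp
    also have "\<dots> \<le> (\<Sum>k\<in>UNIV. \<bar>B $ i $ k\<bar> * K ^ n)"
      by (intro sum_mono) (simp add: abs_mult mult_left_mono Suc)
    also have "\<dots> = (\<Sum>k\<in>UNIV. \<bar>B $ i $ k\<bar>) * K ^ n"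
      by (simp add: sum_distrib_right)
    also have "\<dots> \<le> K * K ^ n"
      using K[of i] K_def by (intro mult_right_mono) (auto intro!: zero_le_power sum_nonneg)
    finally show ?case by simp
  qed
  define c where "c i j n = P n $ i $ j / fact n" for i j n
  have summ: "summable (\<lambda>n. c i j n * t ^ n)" for i j and t :: real
  proof (rule summable_comparison_test[OF _ summable_exp[of "K * \<bar>t\<bar>"]], intro exI allI impI)
    fix n :: nat
    have "\<bar>P n $ i $ j\<bar> * \<bar>t\<bar> ^ n / fact n \<le> K ^ n * \<bar>t\<bar> ^ n / fact n"
      by (intro divide_right_mono mult_right_mono bound) auto
    then show "norm (c i j n * t ^ n) \<le> inverse (fact n) * (K * \<bar>t\<bar>) ^ n"
      by (simp add: c_def abs_mult power_abs power_mult_distrib field_simps)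
  qed
  define E where "E t = (\<chi> i j. \<Sum>n. c i j n * t ^ n)" for t
  have "E 0 = mat 1"
    by (simp add: E_def powser_zero[where f="c i j" for i j] vec_eq_iff) (simp add: c_def P0)
  moreover have "(E has_vector_derivative B ** E t) (at t)" for t
  proof (rule has_vector_derivative_matrixI)
    fix i j
    \<comment> \<open>Differentiation shifts \<open>P n\<close> to
      \<open>P (Suc n) = B ** P n\<close>, so the new coefficients are those of the product with
      \<open>B\<close>.\<close>
    have d: "diffs (c i j) n = (\<Sum>k\<in>UNIV. B $ i $ k * c k j n)" for n
      by (simp add: diffs_def c_def PS matrix_matrix_mult_def sum_divide_distrib sum_distrib_left 
           field_simps del: of_nat_Suc)
    have "(\<Sum>n. diffs (c i j) n * t ^ n) = (\<Sum>n. \<Sum>k\<in>UNIV. B $ i $ k * (c k j n * t ^ n))"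
      by (simp add: d sum_distrib_right mult.assoc)
    also have "\<dots> = (\<Sum>k\<in>UNIV. \<Sum>n. B $ i $ k * (c k j n * t ^ n))"
      by (rule suminf_sum) (intro summable_mult summ)
    also have "\<dots> = (B ** E t) $ i $ j"
      by (simp add: E_def matrix_matrix_mult_def suminf_mult[OF summ])
    finally show "((\<lambda>t. E t $ i $ j) has_field_derivative (B ** E t) $ i $ j) (at t)"
      using termdiffs_strong_converges_everywhere[OF summ, of i j t] by (simp add: E_def)
  qed
  ultimately show ?thesis by blast
qed

section \<open>Quadratic Lyapunov function and exponential decay\<close>

locale matrix_flow =
  fixes A :: "real^'n^'n" and \<sigma> :: real and S E
  assumes sigma: "\<sigma> > 0" and S: "sym_pos_def S" and lyap: "lyapunov A \<sigma> S"
    and E0: "E 0 = mat 1"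
    and E_deriv: "\<And>t. (E has_vector_derivative transpose A ** E t) (at t)"
begin

text \<open>\<open>E t\<close> is the exponential of t A^T, so the flow moves test vectors rather
  than states: \<eta> \<bullet> (exp (t A) x) equals \<open>flow \<eta> t\<close> \<bullet> x.
  Characteristic functions are propagated through their arguments.\<close>

definition flow :: "real^'n \<Rightarrow> real \<Rightarrow> real^'n" where "flow \<eta> t = E t *v \<eta>"

lemma bounded_linear_matrix_vector_left: "bounded_linear (\<lambda>M::real^'n^'n. M *v \<eta>)"
  by (intro linear_conv_bounded_linear[THEN iffD1] linearI)
    (simp_all add: matrix_vector_mult_add_rdistrib scaleR_matrix_vector_assoc)

lemma flow_0: "flow \<eta> 0 = \<eta>" by (simp add: flow_def E0)

lemma flow_deriv: "(flow \<eta> has_vector_derivative transpose A *v flow \<eta> t) (at t)"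
  using bounded_linear.has_vector_derivative[OF bounded_linear_matrix_vector_left E_deriv]
  by (simp add: flow_def[abs_def] matrix_vector_mul_assoc)

lemma continuous_flow: "continuous_on T (flow \<eta>)"
  by (rule continuous_at_imp_continuous_on) (auto intro: has_vector_derivative_continuous flow_deriv)

definition V :: "real^'n \<Rightarrow> real" where "V y = y \<bullet> (S *v y)"

lemma S_sym: "x \<bullet> (S *v y) = y \<bullet> (S *v x)"
  using S unfolding sym_pos_def_def
  by (metis dot_lmul_matrix inner_commute transpose_matrix_vector)

lemma V_deriv:
  "((\<lambda>t. V (flow \<eta> t)) has_real_derivative - \<sigma>\<^sup>2 * (norm (flow \<eta> t))\<^sup>2) (at t)"
proof -
  let ?y = "flow \<eta> t" and ?y' = "transpose A *v flow \<eta> t"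
  have "((\<lambda>t. V (flow \<eta> t)) has_vector_derivative
     ?y \<bullet> (S *v ?y') + ?y' \<bullet> (S *v ?y)) (at t)"
    unfolding V_def
    by (intro bounded_bilinear.has_vector_derivative[OF bounded_bilinear_inner] flow_deriv
        bounded_linear.has_vector_derivative[OF matrix_vector_mul_bounded_linear])
  moreover have "?y \<bullet> (S *v ?y') + ?y' \<bullet> (S *v ?y) = - \<sigma>\<^sup>2 * (norm ?y)\<^sup>2"
  proof -
    have "A ** S + S ** transpose A = - (\<sigma>\<^sup>2 *\<^sub>R mat 1)"
      using lyap unfolding lyapunov_def by (simp add: eq_neg_iff_add_eq_0)
    then have "?y \<bullet> ((A ** S + S ** transpose A) *v ?y) = ?y \<bullet> (- (\<sigma>\<^sup>2 *\<^sub>R mat 1) *v ?y)"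
      by simp
    moreover have "?y' \<bullet> (S *v ?y) = ?y \<bullet> (A *v (S *v ?y))"
      by (simp add: dot_lmul_matrix)
    moreover have "(- (\<sigma>\<^sup>2 *\<^sub>R mat 1)) *v ?y = - (\<sigma>\<^sup>2 *\<^sub>R ?y)"
      by (metis matrix_vector_mul_lid scaleR_matrix_vector_assoc scaleR_minus_left)
    ultimately show ?thesis
      by (simp add: matrix_vector_mult_add_rdistrib inner_add_right matrix_vector_mul_assoc[symmetric]
          power2_norm_eq_inner del: transpose_matrix_vector)
  qed
  ultimately show ?thesis
    by (simp add: has_real_derivative_iff_has_vector_derivative)
qed

text \<open>The lower constant is the minimum of \<open>V\<close> on the compact unit sphere,
  positive by definiteness; homogeneity of degree 2 extends it to every vector. The upper constant
  is an operator bound for \<open>S\<close>.\<close>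

lemma V_bounds: "\<exists>m>0. \<exists>L>0. \<forall>y. m * (norm y)\<^sup>2 \<le> V y \<and> V y \<le> L * (norm y)\<^sup>2"
proof -
  obtain L where L: "L > 0" "\<And>y. norm (S *v y) \<le> L * norm y"
    using bounded_linear.pos_bounded[OF matrix_vector_mul_bounded_linear[of S]]
    by (auto simp: mult.commute)
  have up: "V y \<le> L * (norm y)\<^sup>2" for y
  proof -
    have "V y \<le> norm y * norm (S *v y)" unfolding V_def by (rule norm_cauchy_schwarz)
    also have "\<dots> \<le> norm y * (L * norm y)" by (intro mult_left_mono L) auto
    finally show ?thesis by (simp add: power2_eq_square mult_ac)
  qed
  have "compact (sphere 0 1 :: (real^'n) set)" "sphere 0 1 \<noteq> ({} :: (real^'n) set)"
    by auto
  moreover have "continuous_on (sphere 0 1) V"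
    unfolding V_def by (intro continuous_intros linear_continuous_on matrix_vector_mul_bounded_linear)
  ultimately obtain z where z: "norm z = 1" "\<And>y. norm y = 1 \<Longrightarrow> V z \<le> V y"
    using continuous_attains_inf[of "sphere 0 1" V] by (auto simp: dist_norm)
  have "V z > 0" using S z(1) unfolding sym_pos_def_def V_def by (metis norm_zero zero_neq_one)
  moreover have "V z * (norm y)\<^sup>2 \<le> V y" for y
  proof (cases "y = 0")
    case False
    have "V z \<le> V ((1 / norm y) *\<^sub>R y)" using False by (intro z) simp
    also have "\<dots> = V y / (norm y)\<^sup>2"
      by (simp add: V_def matrix_vector_mult_scaleR power2_eq_square)
    finally show ?thesis using False by (simp add: field_simps)
  qed (simp add: V_def)
  ultimately show ?thesis using L up by blast
qed

text \<open>The bound V \<le> L |y|^2 gives V' \<le> - c V with c =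
  \<open>\<sigma>\<^sup>2 / L\<close>, so exp (c t) V is nonincreasing. Comparison with m |y|^2
  \<le> V and a square root halve the rate and leave the factor \<open>sqrt (L / m)\<close>.
  Stability enters through the definiteness of \<open>S\<close>, not through eigenvalues.\<close>

lemma flow_decay: "\<exists>K\<ge>0. \<exists>c>0. \<forall>\<eta>. \<forall>t\<ge>0. norm (flow \<eta> t) \<le> K * exp (- c * t) * norm \<eta>"
proof -
  obtain m L where mL: "m > 0" "L > 0" "\<And>y. m * (norm y)\<^sup>2 \<le> V y" "\<And>y. V y \<le> L * (norm y)\<^sup>2"
    using V_bounds by blast
  define c where "c = \<sigma>\<^sup>2 / L"
  have c: "c > 0" using mL sigma by (simp add: c_def)
  have "norm (flow \<eta> t) \<le> sqrt (L / m) * exp (- (c / 2) * t) * norm \<eta>" if "t \<ge> 0" for \<eta> t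
  proof -
    have "exp (c * t) * V (flow \<eta> t) \<le> exp (c * 0) * V (flow \<eta> 0)"
    proof (rule DERIV_nonpos_imp_nonincreasing[OF that])
      fix x
      have "((\<lambda>t. exp (c * t) * V (flow \<eta> t)) has_real_derivative
          exp (c * x) * (c * V (flow \<eta> x) - \<sigma>\<^sup>2 * (norm (flow \<eta> x))\<^sup>2)) (at x)"
        by (auto intro!: derivative_eq_intros V_deriv simp: algebra_simps)
      moreover have "c * V (flow \<eta> x) \<le> \<sigma>\<^sup>2 * (norm (flow \<eta> x))\<^sup>2"
        using mult_left_mono[OF mL(4), of c "flow \<eta> x"] c mL by (simp add: c_def)
      ultimately show "\<exists>y. ((\<lambda>t. exp (c * t) * V (flow \<eta> t)) has_real_derivative y) (at x) \<and> y \<le> 0"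
        by (intro exI conjI) (auto simp: mult_le_0_iff)
    qed
    then have "V (flow \<eta> t) \<le> exp (- c * t) * V \<eta>"
      by (simp add: flow_0 exp_minus field_simps)
    then have "m * (norm (flow \<eta> t))\<^sup>2 \<le> exp (- c * t) * (L * (norm \<eta>)\<^sup>2)"
      using mL(3)[of "flow \<eta> t"] mult_left_mono[OF mL(4) exp_ge_zero[of "- c * t"], of \<eta>]
      by linarith
    then have "(norm (flow \<eta> t))\<^sup>2 \<le> (L / m) * exp (- c * t) * (norm \<eta>)\<^sup>2"
      using mL by (simp add: field_simps)
    also have "\<dots> = (sqrt (L / m) * exp (- (c / 2) * t) * norm \<eta>)\<^sup>2"
    proof -
      have "(exp (- (c / 2) * t))\<^sup>2 = exp (- c * t)"
        by (simp flip: exp_double)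
      moreover have "(sqrt (L / m))\<^sup>2 = L / m"
        using mL(1,2) by (intro real_sqrt_pow2) simp
      ultimately show ?thesis by (simp only: power_mult_distrib)
    qed
    finally show ?thesis
      by (rule power2_le_imp_le) (use mL(1,2) in simp)
  qed
  then show ?thesis using c mL(1,2) by (intro exI[of _ "sqrt (L / m)"] conjI exI[of _ "c/2"]) auto
qed

end

subsection \<open>Characteristic functions of Brownian increments\<close>

lemma (in prob_space) iexp_expectation_normal:
  assumes X: "distributed M lborel X (normal_density 0 d)" and d: "d > 0"
  shows "(LINT x|M. iexp (c * X x)) = of_real (exp (- (c * d)\<^sup>2 / 2))"
proof -
  have Z: "distributed M lborel (\<lambda>x. (X x - 0) / d) std_normal_density"
    using X normal_standard_normal_convert[OF d, of X 0] by blast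
  then have eq: "distr M lborel (\<lambda>x. X x / d) = std_normal_distribution"
    by (simp add: distributed_def)
  have [measurable]: "X \<in> borel_measurable M"
    using X by (simp add: distributed_def)
  have "(LINT x|M. iexp (c * X x)) = (LINT x|M. iexp ((c * d) * (X x / d)))"
    using d by simp
  also have "\<dots> = (LINT z|distr M lborel (\<lambda>x. X x / d). iexp ((c * d) * z))"
    by (subst integral_distr) auto
  also have "\<dots> = of_real (exp (- (c * d)\<^sup>2 / 2))"
    unfolding eq char_def[symmetric] char_std_normal_distribution ..
  finally show ?thesis .
qed

text \<open>By Levy uniqueness \<open>X\<close> has the law of \<open>sqrt v * Z\<close> with
  \<open>Z\<close> standard normal, so its moments, and even their existence, are read off from
  those of \<open>Z\<close>. Scaling a standard normal also covers the degenerate case v =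
  0.\<close>

lemma (in prob_space) char_gaussian_moments:
  assumes X[measurable]: "X \<in> borel_measurable M" and v: "v \<ge> 0"
    and char: "\<And>c. (LINT x|M. iexp (c * X x)) = of_real (exp (- (v * c\<^sup>2) / 2))"
  shows "integrable M X" "(LINT x|M. X x) = 0"
    "integrable M (\<lambda>x. (X x)\<^sup>2)" "(LINT x|M. (X x)\<^sup>2) = v"
proof -
  interpret N: real_distribution std_normal_distribution by (rule real_dist_normal_dist)
  have [measurable]: "(\<lambda>z. sqrt v * z) \<in> borel_measurable std_normal_distribution" by simp
  have "distr M borel X = distr std_normal_distribution borel (\<lambda>z. sqrt v * z)"
  proof (rule Levy_uniqueness)
    show "real_distribution (distr M borel X)"
      by (simp add: real_distribution_def real_distribution_axioms_def prob_space_distr)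
    show "real_distribution (distr std_normal_distribution borel (\<lambda>z. sqrt v * z))"
      by (simp add: real_distribution_def real_distribution_axioms_def N.prob_space_distr)
    show "char (distr M borel X) = char (distr std_normal_distribution borel (\<lambda>z. sqrt v * z))"
    proof
      fix c
      have "char (distr std_normal_distribution borel (\<lambda>z. sqrt v * z)) c =
          char std_normal_distribution (c * sqrt v)"
        unfolding char_def by (subst integral_distr) (auto simp: mult_ac)
      also have "\<dots> = of_real (exp (- (v * c\<^sup>2) / 2))"
        using v by (simp add: char_std_normal_distribution power_mult_distrib mult.commute)
      finally show "char (distr M borel X) c = char (distr std_normal_distribution borel (\<lambda>z. sqrt v * z)) c"
        using char[of c] by (simp add: char_def integral_distr[of X M borel "\<lambda>x. iexp (c * x)"] del: of_real_mult)
    qed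
  qed
  note D = this
  have tr_int: "integrable M (\<lambda>x. f (X x)) \<longleftrightarrow> integrable std_normal_distribution (\<lambda>z. f (sqrt v * z))"
    and tr: "(LINT x|M. f (X x)) = (LINT z|std_normal_distribution. f (sqrt v * z))"
    if [measurable]: "f \<in> borel_measurable borel" for f :: "real \<Rightarrow> real"
    using arg_cong[OF D, of "\<lambda>D. integrable D f"] arg_cong[OF D, of "\<lambda>D. integral\<^sup>L D f"]
    by (simp_all add: integrable_distr_eq integral_distr)
  show "integrable M X" "(LINT x|M. X x) = 0"
    using tr_int[of "\<lambda>x. x"] tr[of "\<lambda>x. x"] integrable_std_normal_distribution_moment[of 1]
      integral_std_normal_distribution_moment_odd[of 1] by simp_all
  show "integrable M (\<lambda>x. (X x)\<^sup>2)" "(LINT x|M. (X x)\<^sup>2) = v"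
    using tr_int[of "\<lambda>x. x\<^sup>2"] tr[of "\<lambda>x. x\<^sup>2"] integrable_std_normal_distribution_moment[of 2]
      std_normal_distribution_even_moments[of 1] v by (simp_all add: power_mult_distrib)
qed

text \<open>Passes from independence of a \<sigma>-algebra and the preimages of \<open>Z\<close>,
  the form in \<open>brownian_motion\<close>, to independence of random variables: preimages under h
  o Z are preimages of Borel sets under \<open>Z\<close>.\<close>

lemma (in prob_space) indep_var_subalgebra:
  fixes Z :: "'a \<Rightarrow> 'c::topological_space" and X :: "'a \<Rightarrow> 'd::topological_space" and h :: "'c \<Rightarrow> 'd"
  assumes sub: "subalgebra M G" and X: "X \<in> borel_measurable G"
    and Z[measurable]: "Z \<in> borel_measurable M"
    and indep: "indep_set (sets G) {Z -` B \<inter> space M | B. B \<in> sets borel}"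
    and h[measurable]: "h \<in> borel_measurable borel"
  defines "Y \<equiv> \<lambda>x. h (Z x)"
  shows "indep_var borel X borel Y"
  unfolding indep_var_eq
proof (intro conjI)
  show X': "random_variable borel X" using measurable_from_subalg[OF sub X] .
  show "random_variable borel Y" unfolding Y_def by measurable
  have sp: "space G = space M" using sub by (simp add: subalgebra_def)
  have 1: "sigma_sets (space M) {X -` A \<inter> space M |A. A \<in> sets borel} \<subseteq> sets G"
    using measurable_sets[OF X] sets.sigma_sets_subset[of "{X -` A \<inter> space M |A. A \<in> sets borel}" G]
    by (auto simp: sp)
  \<comment> \<open>Preimages of Borel sets already form a \<sigma>-algebra, so generating one adds
    nothing.\<close>
  have 2: "sigma_sets (space M) {Y -` A \<inter> space M |A. A \<in> sets borel}
     = {Y -` A \<inter> space M |A. A \<in> sets borel}"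
    using sets_vimage_algebra[of "space M" Y borel] sets_vimage_algebra2[of Y "space M" borel] by simp
  have 3: "{Y -` A \<inter> space M |A. A \<in> sets borel} \<subseteq> {Z -` A \<inter> space M |A. A \<in> sets borel}"
  proof safe
    fix A :: "'d set" assume "A \<in> sets borel"
    then have "h -` A \<in> sets borel" using measurable_sets[OF h, of A] by simp
    then show "\<exists>B. Y -` A \<inter> space M = Z -` B \<inter> space M \<and> B \<in> sets borel"
      by (intro exI[of _ "h -` A"]) (auto simp: Y_def)
  qed
  show "indep_set (sigma_sets (space M) {X -` A \<inter> space M |A. A \<in> sets borel})
     (sigma_sets (space M) {Y -` A \<inter> space M |A. A \<in> sets borel})"
    unfolding 2 using indep unfolding indep_set_def
    by (rule indep_sets_mono_sets) (use 1 3 in \<open>auto split: bool.split\<close>)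
qed

lemma (in prob_space) iexp_expectation_gaussian_vector:
  fixes Y :: "'a \<Rightarrow> real^'n"
  assumes Y: "\<And>i. distributed M lborel (\<lambda>x. Y x $ i) (normal_density 0 d)" and d: "d > 0"
    and ind: "indep_vars (\<lambda>_. borel) (\<lambda>i x. Y x $ i) UNIV"
  shows "(LINT x|M. iexp (c \<bullet> Y x)) = of_real (exp (- (d\<^sup>2 * (norm c)\<^sup>2) / 2))"
proof -
  have [measurable]: "(\<lambda>x. Y x $ i) \<in> borel_measurable M" for i
    using Y[of i] by (simp add: distributed_def)
  have "(LINT x|M. iexp (c \<bullet> Y x)) = (LINT x|M. (\<Prod>i\<in>UNIV. iexp (c $ i * Y x $ i)))"
    by (simp add: inner_vec_def sum_distrib_left exp_sum)
  also have "\<dots> = (\<Prod>i\<in>UNIV. (LINT x|M. iexp (c $ i * Y x $ i)))"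
  proof (rule indep_vars_lebesgue_integral)
    show "indep_vars (\<lambda>_. borel) (\<lambda>i x. iexp (c $ i * Y x $ i)) UNIV"
      by (rule indep_vars_compose2[OF ind, where Y="\<lambda>i y. iexp (c $ i * y)"]) simp
    show "integrable M (\<lambda>x. iexp (c $ i * Y x $ i))" for i
      by (rule integrable_iexp) auto
  qed simp
  also have "\<dots> = (\<Prod>i\<in>UNIV. of_real (exp (- (c $ i * d)\<^sup>2 / 2)))"
    by (simp only: iexp_expectation_normal[OF Y d])
  also have "\<dots> = of_real (exp (- (d\<^sup>2 * (norm c)\<^sup>2) / 2))"
  proof -
    have "(\<Prod>i\<in>UNIV. exp (- (c $ i * d)\<^sup>2 / 2)) = exp (\<Sum>i\<in>UNIV. - (c $ i * d)\<^sup>2 / 2)"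
      by (simp add: exp_sum)
    also have "(\<Sum>i\<in>UNIV. - (c $ i * d)\<^sup>2 / 2) = - (d\<^sup>2 * (norm c)\<^sup>2) / 2"
      unfolding power2_norm_eq_inner inner_vec_def
      by (simp add: sum_distrib_left sum_negf sum_divide_distrib power2_eq_square mult_ac)
    finally show ?thesis by (simp only: of_real_prod[symmetric])
  qed
  finally show ?thesis .
qed

section \<open>Brownian increments given the past\<close>

lemma brownian_motionD:
  assumes "brownian_motion M F W"
  shows "prob_space M" "subalgebra M (F t)" "s \<le> t \<Longrightarrow> sets (F s) \<subseteq> sets (F t)" "space (F t) = space M"
    "s \<le> t \<Longrightarrow> (\<lambda>x. W t x - W s x) \<in> borel_measurable (F t)"
    "s \<le> t \<Longrightarrow> borel_measurable (F s) \<subseteq> borel_measurable (F t)"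
    "s \<le> t \<Longrightarrow> (\<lambda>x. W t x - W s x) \<in> borel_measurable M"
proof -
  show a: "prob_space M" "subalgebra M (F t)" "s \<le> t \<Longrightarrow> sets (F s) \<subseteq> sets (F t)" "space (F t) = space M"
    "s \<le> t \<Longrightarrow> (\<lambda>x. W t x - W s x) \<in> borel_measurable (F t)" for s t
    using assms unfolding brownian_motion_def filtration_def by auto
  show "borel_measurable (F s) \<subseteq> borel_measurable (F t)" if "s \<le> t"
    using a(3)[OF that] a(4) by (intro subsetI measurable_from_subalg[of "F t" "F s"]) (simp_all add: subalgebra_def)
  show "s \<le> t \<Longrightarrow> (\<lambda>x. W t x - W s x) \<in> borel_measurable M"
    using measurable_from_subalg[OF a(2) a(5)] .
qed

text \<open>The bounded factor \<open>X\<close> stands in for conditioning: the identity for all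
  such \<open>F s\<close>-measurable \<open>X\<close> determines the conditional characteristic
  function of the increment given \<open>F s\<close>.\<close>

lemma brownian_increment_iexp:
  assumes bm: "brownian_motion M F W" and X: "X \<in> borel_measurable (F s)"
    and X1: "\<And>x. norm (X x :: complex) \<le> 1" and st: "s < t"
  shows "(LINT x|M. X x * iexp (c \<bullet> (W t x - W s x)))
      = (LINT x|M. X x) * of_real (exp (- ((t - s) * (norm c)\<^sup>2) / 2))"
proof -
  interpret prob_space M by (rule brownian_motionD[OF bm])
  note [measurable] = brownian_motionD(7)[OF bm less_imp_le[OF st]]
  have XM[measurable]: "X \<in> borel_measurable M"
    using measurable_from_subalg[OF brownian_motionD(2)[OF bm] X] .
  have props: "\<And>i. distributed M lborel (\<lambda>x. (W t x - W s x) $ i) (normal_density 0 (sqrt (t - s)))"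
      "indep_vars (\<lambda>_. borel) (\<lambda>i x. (W t x - W s x) $ i) UNIV"
      "indep_set (sets (F s)) {(\<lambda>x. W t x - W s x) -` B \<inter> space M | B. B \<in> sets borel}"
    using bm st unfolding brownian_motion_def by blast+
  have "indep_var borel X borel (\<lambda>x. iexp (c \<bullet> (W t x - W s x)))"
    by (rule indep_var_subalgebra[OF brownian_motionD(2)[OF bm] X _ props(3), of "\<lambda>w. iexp (c \<bullet> w)"])
      simp_all
  then have "(LINT x|M. X x * iexp (c \<bullet> (W t x - W s x)))
     = (LINT x|M. X x) * (LINT x|M. iexp (c \<bullet> (W t x - W s x)))"
    by (intro indep_var_lebesgue_integral integrable_iexp)
      (auto simp: comp_def intro!: integrable_const_bound[where B=1] X1)
  also have "(LINT x|M. iexp (c \<bullet> (W t x - W s x))) = of_real (exp (- ((t - s) * (norm c)\<^sup>2) / 2))"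
    using iexp_expectation_gaussian_vector[OF props(1) _ props(2), of c] st by simp
  finally show ?thesis .
qed

text \<open>Increments are peeled off from the latest one: the earlier ones together with
  \<open>X\<close> form a bounded factor measurable with respect to \<open>F (p n)\<close>, to which
  the one-increment lemma applies.\<close>

lemma brownian_sum_iexp:
  fixes c :: "nat \<Rightarrow> real^'n"
  assumes bm: "brownian_motion M F W" and X: "X \<in> borel_measurable (F (p 0))"
    and X1: "\<And>x. norm (X x :: complex) \<le> 1" and p: "\<And>k. p k < p (Suc k)"
  shows "(LINT x|M. X x * iexp (\<Sum>k<n. c k \<bullet> (W (p (Suc k)) x - W (p k) x)))
      = (LINT x|M. X x) * of_real (exp (- (\<Sum>k<n. (p (Suc k) - p k) * (norm (c k))\<^sup>2) / 2))"
proof (induction n)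
  case (Suc n)
  define Y where "Y x = X x * iexp (\<Sum>k<n. c k \<bullet> (W (p (Suc k)) x - W (p k) x))" for x
  have mono: "p i \<le> p j" if "i \<le> j" for i j
    using that by (rule lift_Suc_mono_le[of p, rotated]) (simp add: less_imp_le p)
  have [measurable]: "X \<in> borel_measurable (F (p n))"
    using brownian_motionD(6)[OF bm mono[of 0 n]] X by auto
  have [measurable]: "(\<lambda>x. W (p (Suc k)) x - W (p k) x) \<in> borel_measurable (F (p n))" if "k < n" for k
    using brownian_motionD(6)[OF bm mono[of "Suc k" n]] that
      brownian_motionD(5)[OF bm mono[of k "Suc k"]] by auto
  have "Y \<in> borel_measurable (F (p n))"
    unfolding Y_def by (intro borel_measurable_times) measurable
  moreover have "norm (Y x) \<le> 1" for x
    using X1[of x] by (simp add: Y_def norm_mult)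
  ultimately have "(LINT x|M. Y x * iexp (c n \<bullet> (W (p (Suc n)) x - W (p n) x)))
     = (LINT x|M. Y x) * of_real (exp (- ((p (Suc n) - p n) * (norm (c n))\<^sup>2) / 2))"
    using p by (intro brownian_increment_iexp[OF bm])
  moreover have "Y x * iexp (c n \<bullet> (W (p (Suc n)) x - W (p n) x))
     = X x * iexp (\<Sum>k<Suc n. c k \<bullet> (W (p (Suc k)) x - W (p k) x))" for x
    by (simp add: Y_def distrib_left exp_add)
  moreover have "(LINT x|M. Y x)
      = (LINT x|M. X x) * of_real (exp (- (\<Sum>k<n. (p (Suc k) - p k) * (norm (c k))\<^sup>2) / 2))"
    unfolding Y_def by (rule Suc)
  moreover have "exp (- (\<Sum>k<Suc n. (p (Suc k) - p k) * (norm (c k))\<^sup>2) / 2)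
      = exp (- (\<Sum>k<n. (p (Suc k) - p k) * (norm (c k))\<^sup>2) / 2)
        * exp (- ((p (Suc n) - p n) * (norm (c n))\<^sup>2) / 2)"
    unfolding exp_add[symmetric] by (rule arg_cong[of _ _ exp]) (simp add: field_simps)
  ultimately show ?case
    by (simp only: of_real_mult mult.assoc)
qed simp

subsection \<open>Variation of constants\<close>

text \<open>Dividing by \<open>Suc n\<close> gives \<open>Suc n\<close> equal cells, so the mesh
  makes sense for every \<open>n\<close>, with the endpoints at indices 0 and
  \<open>Suc n\<close>.\<close>

definition grid :: "real \<Rightarrow> real \<Rightarrow> nat \<Rightarrow> nat \<Rightarrow> real" where
  "grid s t n k = s + (t - s) * real k / real (Suc n)"

lemma grid_0: "grid s t n 0 = s" and grid_last: "grid s t n (Suc n) = t"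
  unfolding grid_def by (simp_all add: nonzero_mult_div_cancel_right[OF of_nat_neq_0] del: of_nat_Suc)

lemma grid_step: "grid s t n (Suc k) - grid s t n k = (t - s) / real (Suc n)"
proof -
  have "real (Suc k) - real k = 1" by simp
  then show ?thesis
    unfolding grid_def add_diff_cancel_left diff_divide_distrib[symmetric] right_diff_distrib[symmetric]
    by simp
qed

lemma grid_less: "s < t \<Longrightarrow> grid s t n k < grid s t n (Suc k)"
  unfolding diff_gt_0_iff_gt[of "grid s t n (Suc k)", symmetric] grid_step by simp

lemma grid_mem:
  assumes "s < t" "k \<le> Suc n" shows "s \<le> grid s t n k" "grid s t n k \<le> t"
proof -
  show "s \<le> grid s t n k" using assms by (simp add: grid_def)
  have "(t - s) * (real k / real (Suc n)) \<le> (t - s) * 1"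
    using assms by (intro mult_left_mono) (simp_all add: divide_le_eq_1)
  then show "grid s t n k \<le> t" by (simp add: grid_def)
qed

text \<open>The two-point function \<open>d\<close> matches the increments of \<open>g\<close> up to
  o(v - u), uniformly on [s, t]. Sums of \<open>d\<close> over fine grids then recover g t - g s,
  which serves both the noise sums along a path and their variances.\<close>

definition approx_increments :: "real \<Rightarrow> real \<Rightarrow> (real \<Rightarrow> real) \<Rightarrow> (real \<Rightarrow> real \<Rightarrow> real) \<Rightarrow> bool" where
  "approx_increments s t g d \<longleftrightarrow> (\<forall>e>0. \<exists>\<delta>>0. \<forall>u v. s \<le> u \<and> u \<le> v \<and> v \<le> t \<and> v - u < \<delta> \<longrightarrow>
     \<bar>g v - g u - d u v\<bar> \<le> e * (v - u))"

lemma approx_increments_sum: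
  assumes d: "approx_increments s t g d" and st: "s < t"
  shows "(\<lambda>n. \<Sum>k<Suc n. d (grid s t n k) (grid s t n (Suc k))) \<longlonglongrightarrow> g t - g s"
proof (rule LIMSEQ_I)
  fix r :: real assume r: "r > 0"
  define e where "e = r / (2 * (t - s))"
  have e: "e > 0" using r st by (simp add: e_def)
  obtain \<delta> where \<delta>: "\<delta> > 0"
    "\<And>u v. s \<le> u \<Longrightarrow> u \<le> v \<Longrightarrow> v \<le> t \<Longrightarrow> v - u < \<delta> \<Longrightarrow> \<bar>g v - g u - d u v\<bar> \<le> e * (v - u)"
    using d e unfolding approx_increments_def by meson
  obtain N where N: "(t - s) / \<delta> < real N" using reals_Archimedean2 by blast
  have "norm ((\<Sum>k<Suc n. d (grid s t n k) (grid s t n (Suc k))) - (g t - g s)) < r" if "n \<ge> N" for n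
  proof -
    have small: "(t - s) / real (Suc n) < \<delta>"
    proof -
      have "(t - s) / \<delta> < real (Suc n)" using N that by linarith
      then show ?thesis using \<delta>(1) by (simp add: field_simps del: of_nat_Suc)
    qed
    have tel: "g t - g s = (\<Sum>k<Suc n. g (grid s t n (Suc k)) - g (grid s t n k))"
      unfolding sum_lessThan_telescope[of "\<lambda>k. g (grid s t n k)"] grid_0 grid_last ..
    have "norm ((\<Sum>k<Suc n. d (grid s t n k) (grid s t n (Suc k))) - (g t - g s))
      = \<bar>\<Sum>k<Suc n. g (grid s t n (Suc k)) - g (grid s t n k) - d (grid s t n k) (grid s t n (Suc k))\<bar>"
      unfolding tel real_norm_def by (subst abs_minus_commute) (simp only: sum_subtractf)
    also have "\<dots> \<le> (\<Sum>k<Suc n. \<bar>g (grid s t n (Suc k)) - g (grid s t n k) - d (grid s t n k) (grid s t n (Suc k))\<bar>)"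
      by (rule sum_abs)
    also have "\<dots> \<le> (\<Sum>k<Suc n. e * (grid s t n (Suc k) - grid s t n k))"
    proof (rule sum_mono)
      fix k assume k: "k \<in> {..<Suc n}"
      then show "\<bar>g (grid s t n (Suc k)) - g (grid s t n k) - d (grid s t n k) (grid s t n (Suc k))\<bar>
          \<le> e * (grid s t n (Suc k) - grid s t n k)"
        using small st grid_less[OF st, of n k] by (intro \<delta>(2) grid_mem) (simp_all add: grid_step)
    qed
    also have "\<dots> = e * (t - s)"
      by (simp only: sum_distrib_left[symmetric] sum_lessThan_telescope grid_0 grid_last)
    also have "\<dots> = r / 2" using st unfolding e_def by (simp add: field_simps)
    also have "\<dots> < r" using r by simp
    finally show ?thesis .
  qed
  then show "\<exists>no. \<forall>n\<ge>no. norm ((\<Sum>k<Suc n. d (grid s t n k) (grid s t n (Suc k))) - (g t - g s)) < r"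
    by blast
qed

text \<open>The defect g v - g u - d u v is an integral over [u, v] of an integrand that vanishes
  when its three arguments agree. Uniform continuity on the compact cube makes the integrand small
  once [u, v] is short.\<close>

lemma approx_increments_integral:
  assumes cont: "continuous_on ({s..t} \<times> {s..t} \<times> {s..t}) (\<lambda>(u, v, r). f u v r)"
    and diag: "\<And>u. s \<le> u \<Longrightarrow> u \<le> t \<Longrightarrow> f u u u = 0"
    and int: "\<And>u v. s \<le> u \<Longrightarrow> u \<le> v \<Longrightarrow> v \<le> t \<Longrightarrow> (f u v has_integral (g v - g u - d u v)) {u..v}"
  shows "approx_increments s t g d"
  unfolding approx_increments_def
proof (intro allI impI)
  fix e :: real assume e: "e > 0"
  have "uniformly_continuous_on ({s..t} \<times> {s..t} \<times> {s..t}) (\<lambda>(u, v, r). f u v r)"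
    by (intro compact_uniformly_continuous cont compact_Times) auto
  then obtain \<delta> where \<delta>: "\<delta> > 0" "\<And>x x'. x \<in> {s..t} \<times> {s..t} \<times> {s..t} \<Longrightarrow> x' \<in> {s..t} \<times> {s..t} \<times> {s..t}
      \<Longrightarrow> dist x' x < \<delta> \<Longrightarrow> dist ((\<lambda>(u, v, r). f u v r) x') ((\<lambda>(u, v, r). f u v r) x) < e"
    using e unfolding uniformly_continuous_on_def by meson
  show "\<exists>\<delta>>0. \<forall>u v. s \<le> u \<and> u \<le> v \<and> v \<le> t \<and> v - u < \<delta> \<longrightarrow> \<bar>g v - g u - d u v\<bar> \<le> e * (v - u)"
  \<comment> \<open>The point (u, v, r) differs from (u, u, u) in two coordinates, each by less than
    half of \<delta>.\<close>
  proof (intro exI[of _ "\<delta> / 2"] conjI allI impI)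
    fix u v assume uv: "s \<le> u \<and> u \<le> v \<and> v \<le> t \<and> v - u < \<delta> / 2"
    have "\<bar>f u v r\<bar> \<le> e" if r: "r \<in> {u..v}" for r
    proof -
      have "dist (u, v, r) (u, u, u) \<le> dist v u + dist r u"
        using sqrt_sum_squares_le_sum_abs[of "dist v u" "dist r u"] by (simp add: dist_Pair_Pair)
      also have "\<dots> < \<delta>" using r uv by (simp add: dist_real_def)
      finally have "dist (f u v r) (f u u u) < e"
        using \<delta>(2)[of "(u, u, u)" "(u, v, r)"] uv r by simp
      then show ?thesis using diag[of u] uv by (simp add: dist_real_def)
    qed
    then show "\<bar>g v - g u - d u v\<bar> \<le> e * (v - u)"
      using has_integral_bound_real[OF _ finite.emptyI int, of e u v] uv e by simp
  qed (use \<delta> in simp)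
qed

section \<open>Characteristic function of the process given the past\<close>

context matrix_flow
begin

text \<open>
  For \<open>y = flow \<eta> (t - u)\<close> the drift of \<open>y \<bullet> \<xi> u\<close> cancels, so the scalar process is driven by the
  noise alone. Its noise integral appears only through sums over a grid, which converge path
  by path since the integrand is smooth and deterministic.
\<close>
lemma variation_of_constants_increments:
  assumes cont: "continuous_on {s..t} \<xi>"
    and eq: "\<And>u v. s \<le> u \<Longrightarrow> u \<le> v \<Longrightarrow> v \<le> t \<Longrightarrow>
       \<xi> v - \<xi> u = integral {u..v} (\<lambda>r. A *v \<xi> r) + \<sigma> *\<^sub>R (w v - w u)"
  shows "approx_increments s t (\<lambda>u. flow \<eta> (t - u) \<bullet> \<xi> u)
     (\<lambda>u v. (\<sigma> *\<^sub>R flow \<eta> (t - u)) \<bullet> (w v - w u))"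
proof (rule approx_increments_integral)
  \<comment> \<open>With y_u = \<open>flow \<eta> (t - u)\<close>, the increment of y \<bullet>
    \<xi> is y_u \<bullet> (\<xi> v - \<xi> u) + (y_v - y_u) \<bullet> \<xi> v. The equation turns
    the first term, less the noise, into the integral of y_u \<bullet> A \<xi> r; the flow turns the
    second into minus the integral of y_r \<bullet> A \<xi> v. The two integrands agree at u = v =
    r.\<close>
  let ?f = "\<lambda>u v r. flow \<eta> (t - u) \<bullet> (A *v \<xi> r) - flow \<eta> (t - r) \<bullet> (A *v \<xi> v)"
  have cflow: "continuous_on T (\<lambda>x. flow \<eta> (h x))" if "continuous_on T h" for T and h :: "real \<times> real \<times> real \<Rightarrow> real"
    using continuous_on_compose2[OF continuous_flow[of UNIV \<eta>] that] by simp
  have cxi: "continuous_on T (\<lambda>x. A *v \<xi> (h x))" if "continuous_on T h" "h ` T \<subseteq> {s..t}"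
    for T and h :: "real \<times> real \<times> real \<Rightarrow> real"
    using linear_continuous_on_compose[OF continuous_on_compose2[OF cont that] matrix_vector_mul_linear] .
  have "continuous_on ({s..t} \<times> {s..t} \<times> {s..t}) (\<lambda>x. ?f (fst x) (fst (snd x)) (snd (snd x)))"
    by (intro continuous_intros cflow cxi) auto
  then show "continuous_on ({s..t} \<times> {s..t} \<times> {s..t}) (\<lambda>(u, v, r). ?f u v r)"
    by (simp add: case_prod_unfold)
  fix u v assume uv: "s \<le> u" "u \<le> v" "v \<le> t"
  have "((\<lambda>r. A *v \<xi> r) has_integral (\<xi> v - \<xi> u - \<sigma> *\<^sub>R (w v - w u))) {u..v}"
  proof -
    have "continuous_on {u..v} (\<lambda>r. A *v \<xi> r)"
      using uv by (intro linear_continuous_on_compose[OF continuous_on_subset[OF cont] matrix_vector_mul_linear]) auto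
    then have "(\<lambda>r. A *v \<xi> r) integrable_on {u..v}" by (rule integrable_continuous_interval)
    then show ?thesis using eq[OF uv] by (simp add: has_integral_integral)
  qed
  from has_integral_linear[OF this bounded_linear_inner_right[of "flow \<eta> (t - u)"]]
  have 1: "((\<lambda>r. flow \<eta> (t - u) \<bullet> (A *v \<xi> r)) has_integral
      (flow \<eta> (t - u) \<bullet> (\<xi> v - \<xi> u - \<sigma> *\<^sub>R (w v - w u)))) {u..v}"
    by (simp add: comp_def)
  have "((\<lambda>r. - (flow \<eta> (t - r) \<bullet> (A *v \<xi> v))) has_integral
      flow \<eta> (t - v) \<bullet> \<xi> v - flow \<eta> (t - u) \<bullet> \<xi> v) {u..v}"
  proof (rule fundamental_theorem_of_calculus[OF uv(2)])
    fix r
    have "((\<lambda>r. flow \<eta> (t - r)) has_vector_derivative (- 1) *\<^sub>R (transpose A *v flow \<eta> (t - r))) (at r)"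
    proof -
      have "((\<lambda>r. t - r) has_vector_derivative - 1) (at r)"
        by (auto intro!: derivative_eq_intros)
      from vector_diff_chain_at[OF this flow_deriv] show ?thesis by (simp only: comp_def)
    qed
    then have "((\<lambda>r. flow \<eta> (t - r) \<bullet> \<xi> v) has_vector_derivative
        ((- 1) *\<^sub>R (transpose A *v flow \<eta> (t - r))) \<bullet> \<xi> v) (at r)"
      by (rule bounded_linear.has_vector_derivative[OF bounded_linear_inner_left])
    then show "((\<lambda>r. flow \<eta> (t - r) \<bullet> \<xi> v) has_vector_derivative
        - (flow \<eta> (t - r) \<bullet> (A *v \<xi> v))) (at r within {u..v})"
      by (simp add: dot_lmul_matrix has_vector_derivative_at_within)
  qed
  from has_integral_add[OF 1 this]
  show "(?f u v has_integral (flow \<eta> (t - v) \<bullet> \<xi> v - flow \<eta> (t - u) \<bullet> \<xi> u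
      - (\<sigma> *\<^sub>R flow \<eta> (t - u)) \<bullet> (w v - w u))) {u..v}"
    by (simp add: inner_diff_right inner_add_right algebra_simps)
qed simp

text \<open>Supplies the limiting variance of the noise sums: their cell variances are left Riemann
  sums of \<open>\<sigma>\<^sup>2\<close> |y|^2, which is the derivative of \<open>V\<close> along
  the time-reversed flow.\<close>

lemma V_increments:
  "approx_increments s t (\<lambda>u. V (flow \<eta> (t - u))) (\<lambda>u v. (v - u) * (norm (\<sigma> *\<^sub>R flow \<eta> (t - u)))\<^sup>2)"
proof (rule approx_increments_integral)
  let ?f = "\<lambda>u v r. \<sigma>\<^sup>2 * (norm (flow \<eta> (t - r)))\<^sup>2 - \<sigma>\<^sup>2 * (norm (flow \<eta> (t - u)))\<^sup>2"
  have cflow: "continuous_on T (\<lambda>x. flow \<eta> (h x))" if "continuous_on T h" for T and h :: "real \<times> real \<times> real \<Rightarrow> real"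
    using continuous_on_compose2[OF continuous_flow[of UNIV \<eta>] that] by simp
  have "continuous_on ({s..t} \<times> {s..t} \<times> {s..t}) (\<lambda>x. ?f (fst x) (fst (snd x)) (snd (snd x)))"
    by (intro continuous_intros cflow)
  then show "continuous_on ({s..t} \<times> {s..t} \<times> {s..t}) (\<lambda>(u, v, r). ?f u v r)"
    by (simp add: case_prod_unfold)
  fix u v :: real assume uv: "u \<le> v"
  have "((\<lambda>r. \<sigma>\<^sup>2 * (norm (flow \<eta> (t - r)))\<^sup>2) has_integral
      V (flow \<eta> (t - v)) - V (flow \<eta> (t - u))) {u..v}"
  proof (rule fundamental_theorem_of_calculus[OF uv])
    fix r
    have "((\<lambda>r. V (flow \<eta> (t - r))) has_real_derivative - \<sigma>\<^sup>2 * (norm (flow \<eta> (t - r)))\<^sup>2 * (- 1)) (at r)"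
      by (rule DERIV_chain2[OF V_deriv]) (auto intro!: derivative_eq_intros)
    then show "((\<lambda>r. V (flow \<eta> (t - r))) has_vector_derivative \<sigma>\<^sup>2 * (norm (flow \<eta> (t - r)))\<^sup>2) (at r within {u..v})"
      by (simp add: has_real_derivative_iff_has_vector_derivative has_vector_derivative_at_within)
  qed
  from has_integral_diff[OF this has_integral_const_real[of "\<sigma>\<^sup>2 * (norm (flow \<eta> (t - u)))\<^sup>2" u v]]
  show "(?f u v has_integral (V (flow \<eta> (t - v)) - V (flow \<eta> (t - u))
      - (v - u) * (norm (\<sigma> *\<^sub>R flow \<eta> (t - u)))\<^sup>2)) {u..v}"
    using uv by (simp add: power_mult_distrib)
qed simp

text \<open>One sequence of expectations has two limits: path by path the grid sums converge to
  \<eta> \<bullet> \<xi> t - \<open>flow \<eta> (t - s)\<close> \<bullet> \<xi> s, while their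
  Gaussian characteristic functions are explicit with convergent variances.\<close>

lemma ou_iexp:
  assumes ou: "ou_process M F W A \<sigma> \<xi>" and X: "X \<in> borel_measurable (F s)"
    and X1: "\<And>x. norm (X x :: complex) \<le> 1" and st: "s \<le> t"
  shows "(LINT x|M. X x * iexp (\<eta> \<bullet> \<xi> t x))
      = (LINT x|M. X x * iexp (flow \<eta> (t - s) \<bullet> \<xi> s x)) * of_real (exp (- (V \<eta> - V (flow \<eta> (t - s))) / 2))"
proof (cases "s = t")
  case True
  then show ?thesis by (simp add: flow_0)
next
  case False
  then have st: "s < t" using st by simp
  have bm: "brownian_motion M F W" and xi: "\<And>t. \<xi> t \<in> borel_measurable (F t)"
    and ae: "AE x in M. continuous_on UNIV (\<lambda>t. \<xi> t x)"
      "AE x in M. \<forall>s t. s \<le> t \<longrightarrow>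
        \<xi> t x - \<xi> s x = integral {s..t} (\<lambda>u. A *v \<xi> u x) + \<sigma> *\<^sub>R (W t x - W s x)"
    using ou unfolding ou_process_def by auto
  interpret prob_space M by (rule brownian_motionD[OF bm])
  note sub = brownian_motionD(2)[OF bm]
  have xiM[measurable]: "\<xi> t \<in> borel_measurable M" for t
    by (rule measurable_from_subalg[OF sub xi])
  have XM[measurable]: "X \<in> borel_measurable M"
    by (rule measurable_from_subalg[OF sub X])
  define p where "p n k = grid s t n k" for n k
  have p: "p n k < p n (Suc k)" for n k using grid_less[OF st] by (simp add: p_def)
  have WM[measurable]: "(\<lambda>x. W (p n (Suc k)) x - W (p n k) x) \<in> borel_measurable M" for n k
    by (rule brownian_motionD(7)[OF bm less_imp_le[OF p]])
  define c where "c n k = \<sigma> *\<^sub>R flow \<eta> (t - p n k)" for n k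
  \<comment> \<open>The contribution of the state at \<open>s\<close> joins the bounded factor, so
    only noise after \<open>s\<close> remains.\<close>
  define Y where "Y x = X x * iexp (flow \<eta> (t - s) \<bullet> \<xi> s x)" for x
  define Z where "Z n x = (\<Sum>k<Suc n. c n k \<bullet> (W (p n (Suc k)) x - W (p n k) x))" for n x
  have YM: "Y \<in> borel_measurable (F s)"
  proof -
    note [measurable] = xi[of s] X
    show ?thesis unfolding Y_def by measurable
  qed
  have [measurable]: "Y \<in> borel_measurable M" by (rule measurable_from_subalg[OF sub YM])
  have Y1: "norm (Y x) \<le> 1" for x using X1[of x] by (simp add: Y_def norm_mult)
  have "(\<lambda>n. LINT x|M. Y x * iexp (Z n x)) \<longlonglongrightarrow> (LINT x|M. X x * iexp (\<eta> \<bullet> \<xi> t x))"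
  proof (rule integral_dominated_convergence[where w="\<lambda>_. 1"])
    show "AE x in M. (\<lambda>n. Y x * iexp (Z n x)) \<longlonglongrightarrow> X x * iexp (\<eta> \<bullet> \<xi> t x)"
      using ae
    proof eventually_elim
      case (elim x)
      have "approx_increments s t (\<lambda>u. flow \<eta> (t - u) \<bullet> \<xi> u x)
         (\<lambda>u v. (\<sigma> *\<^sub>R flow \<eta> (t - u)) \<bullet> (W v x - W u x))"
        using elim by (intro variation_of_constants_increments) (auto intro: continuous_on_subset)
      from approx_increments_sum[OF this st]
      have "(\<lambda>n. Z n x) \<longlonglongrightarrow> \<eta> \<bullet> \<xi> t x - flow \<eta> (t - s) \<bullet> \<xi> s x"
        by (simp only: Z_def c_def p_def diff_self flow_0)
      then have "(\<lambda>n. Y x * iexp (Z n x)) \<longlonglongrightarrow> Y x * iexp (\<eta> \<bullet> \<xi> t x - flow \<eta> (t - s) \<bullet> \<xi> s x)"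
        by (intro tendsto_intros)
      also have "Y x * iexp (\<eta> \<bullet> \<xi> t x - flow \<eta> (t - s) \<bullet> \<xi> s x) = X x * iexp (\<eta> \<bullet> \<xi> t x)"
        by (simp add: Y_def algebra_simps exp_diff)
      finally show ?case .
    qed
    show "AE x in M. norm (Y x * iexp (Z n x)) \<le> 1" for n
      using Y1 by (simp add: norm_mult)
  qed (auto simp: Z_def)
  moreover have "(\<lambda>n. LINT x|M. Y x * iexp (Z n x))
    \<longlonglongrightarrow> (LINT x|M. Y x) * of_real (exp (- (V \<eta> - V (flow \<eta> (t - s))) / 2))"
  proof -
    have "(LINT x|M. Y x * iexp (Z n x))
       = (LINT x|M. Y x) * of_real (exp (- (\<Sum>k<Suc n. (p n (Suc k) - p n k) * (norm (c n k))\<^sup>2) / 2))" for n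
      unfolding Z_def using YM by (intro brownian_sum_iexp[OF bm _ Y1] p) (simp add: p_def grid_0)
    moreover have "(\<lambda>n. \<Sum>k<Suc n. (p n (Suc k) - p n k) * (norm (c n k))\<^sup>2) \<longlonglongrightarrow> V \<eta> - V (flow \<eta> (t - s))"
      using approx_increments_sum[OF V_increments st] by (simp only: p_def c_def diff_self flow_0)
    ultimately show ?thesis by (simp only:) (intro tendsto_intros; simp)
  qed
  ultimately show ?thesis
    unfolding Y_def using LIMSEQ_unique by blast
qed

lemma stationary_expectation:
  assumes st: "stationary M \<xi>" and m[measurable]: "\<And>t. \<xi> t \<in> borel_measurable M"
    and f[measurable]: "(f :: real^'n \<Rightarrow> complex) \<in> borel_measurable borel"
  shows "(LINT x|M. f (\<xi> t x)) = (LINT x|M. f (\<xi> s x))"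
proof -
  \<comment> \<open>A one-point index set suffices; the shift \<open>t - s\<close> carries time
    \<open>s\<close> to \<open>t\<close>.\<close>
  have "distr M (PiM {s} (\<lambda>_. borel)) (\<lambda>x. \<lambda>r\<in>{s}. \<xi> (r + (t - s)) x) =
        distr M (PiM {s} (\<lambda>_. borel)) (\<lambda>x. \<lambda>r\<in>{s}. \<xi> r x)"
    using st unfolding stationary_def by blast
  then have "(LINT z|distr M (PiM {s} (\<lambda>_. borel)) (\<lambda>x. \<lambda>r\<in>{s}. \<xi> (r + (t - s)) x). f (z s)) =
        (LINT z|distr M (PiM {s} (\<lambda>_. borel)) (\<lambda>x. \<lambda>r\<in>{s}. \<xi> r x). f (z s))"
    by simp
  then show ?thesis by (simp add: integral_distr)
qed

end

subsection \<open>Autocovariance of the stationary process\<close>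

context matrix_flow
begin

lemma flow_tendsto_0: "(\<lambda>n. flow \<eta> (real n)) \<longlonglongrightarrow> 0"
proof -
  obtain K c where K: "c > 0" "\<And>\<eta> t. t \<ge> 0 \<Longrightarrow> norm (flow \<eta> t) \<le> K * exp (- c * t) * norm \<eta>"
    using flow_decay by blast
  have "(\<lambda>n. K * exp (- c * real n) * norm \<eta>) \<longlonglongrightarrow> K * 0 * norm \<eta>"
    by (intro tendsto_intros filterlim_compose[OF exp_at_bot]
        filterlim_tendsto_neg_mult_at_bot[OF tendsto_const] filterlim_real_sequentially) (use K in simp)
  then have lim: "(\<lambda>n. K * exp (- c * real n) * norm \<eta>) \<longlonglongrightarrow> 0"
    by simp
  show ?thesis
    by (rule Lim_null_comparison[OF always_eventually lim]) (use K(2) in simp)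
qed

lemma V_add: "V (x + y) = V x + 2 * (x \<bullet> (S *v y)) + V y"
  using S_sym[of x y] by (simp add: V_def matrix_vector_right_distrib inner_add_left inner_add_right)

lemma V_scaleR: "V (c *\<^sub>R x) = c\<^sup>2 * V x"
  by (simp add: V_def matrix_vector_mult_scaleR power2_eq_square)

lemma V_nonneg: "V x \<ge> 0"
  using S unfolding V_def sym_pos_def_def by (cases "x = 0") (auto intro: less_imp_le)

lemma V_flow_le: "t \<ge> 0 \<Longrightarrow> V (flow \<eta> t) \<le> V \<eta>"
  using DERIV_nonpos_imp_nonincreasing[of 0 t "\<lambda>t. V (flow \<eta> t)"] V_deriv[of \<eta>]
  by (fastforce simp: flow_0 mult_nonneg_nonneg)

lemma flow_scaleR: "flow (c *\<^sub>R \<eta>) t = c *\<^sub>R flow \<eta> t"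
  by (simp add: flow_def matrix_vector_mult_scaleR)

text \<open>By stationarity one function \<phi> serves every time, so conditioning on time 0 relates
  \<phi> \<eta> to \<phi> at the flowed argument. The flow tends to 0, where \<phi> equals 1, and
  only the Gaussian factor survives.\<close>

lemma stationary_iexp:
  assumes ou: "stationary_ou M F W A \<sigma> \<xi>"
  shows "(LINT x|M. iexp (\<eta> \<bullet> \<xi> t x)) = of_real (exp (- V \<eta> / 2))"
proof -
  have ou': "ou_process M F W A \<sigma> \<xi>" and st: "stationary M \<xi>" and bm: "brownian_motion M F W"
    using ou unfolding stationary_ou_def ou_process_def by auto
  interpret prob_space M by (rule brownian_motionD[OF bm])
  have m[measurable]: "\<xi> t \<in> borel_measurable M" for t
    using ou' measurable_from_subalg[OF brownian_motionD(2)[OF bm]] unfolding ou_process_def by blast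
  define \<phi> where "\<phi> y = (LINT x|M. iexp (y \<bullet> \<xi> 0 x))" for y
  have \<phi>: "(LINT x|M. iexp (y \<bullet> \<xi> t x)) = \<phi> y" for y t
    unfolding \<phi>_def by (rule stationary_expectation[OF st m, of "\<lambda>z. iexp (y \<bullet> z)"]) simp
  have eq: "(\<lambda>n. \<phi> (flow \<eta> (real n)) * of_real (exp (- (V \<eta> - V (flow \<eta> (real n))) / 2))) = (\<lambda>n. \<phi> \<eta>)"
    using ou_iexp[OF ou', of "\<lambda>_. 1" 0 "real n" \<eta> for n] by (simp add: \<phi> fun_eq_iff)
  have 1: "(\<lambda>n. \<phi> (flow \<eta> (real n))) \<longlonglongrightarrow> (LINT x|M. iexp (0 \<bullet> \<xi> 0 x))"
    unfolding \<phi>_def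
  proof (rule integral_dominated_convergence[where w="\<lambda>_. 1"])
    show "AE x in M. (\<lambda>n. iexp (flow \<eta> (real n) \<bullet> \<xi> 0 x)) \<longlonglongrightarrow> iexp (0 \<bullet> \<xi> 0 x)"
      by (intro AE_I2 tendsto_intros flow_tendsto_0)
  qed auto
  have 2: "(\<lambda>n. V (flow \<eta> (real n))) \<longlonglongrightarrow> 0"
    unfolding V_def
    using tendsto_inner[OF flow_tendsto_0 bounded_linear.tendsto[OF matrix_vector_mul_bounded_linear flow_tendsto_0]]
    by simp
  have "(\<lambda>n. \<phi> (flow \<eta> (real n)) * of_real (exp (- (V \<eta> - V (flow \<eta> (real n))) / 2)))
      \<longlonglongrightarrow> (LINT x|M. iexp (0 \<bullet> \<xi> 0 x)) * of_real (exp (- (V \<eta> - 0) / 2))"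
    by (intro tendsto_intros 1 2) simp
  then have "(\<lambda>n. \<phi> \<eta>) \<longlonglongrightarrow> of_real (exp (- V \<eta> / 2))"
    unfolding eq by (simp add: prob_space)
  then show ?thesis by (simp add: \<phi> LIMSEQ_const_iff)
qed

text \<open>Conditioning on the past of \<open>s\<close> merges both exponents into \<theta> + y
  with y = \<open>flow \<eta> (t - s)\<close>. In V (\<theta> + y) + V \<eta> - V y the term V y
  cancels, leaving twice the cross term \<theta> \<bullet> S y.\<close>

lemma joint_iexp:
  assumes ou: "stationary_ou M F W A \<sigma> \<xi>" and st: "s \<le> t"
  shows "(LINT x|M. iexp (\<theta> \<bullet> \<xi> s x + \<eta> \<bullet> \<xi> t x))
     = of_real (exp (- (V \<theta> + 2 * (\<theta> \<bullet> (S *v flow \<eta> (t - s))) + V \<eta>) / 2))"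
proof -
  have ou': "ou_process M F W A \<sigma> \<xi>" and [measurable]: "\<xi> s \<in> borel_measurable (F s)"
    using ou unfolding stationary_ou_def ou_process_def by auto
  let ?y = "flow \<eta> (t - s)"
  have "(LINT x|M. iexp (\<theta> \<bullet> \<xi> s x + \<eta> \<bullet> \<xi> t x)) = (LINT x|M. iexp (\<theta> \<bullet> \<xi> s x) * iexp (\<eta> \<bullet> \<xi> t x))"
    by (simp add: distrib_left exp_add)
  also have "\<dots> = (LINT x|M. iexp (\<theta> \<bullet> \<xi> s x) * iexp (?y \<bullet> \<xi> s x)) * of_real (exp (- (V \<eta> - V ?y) / 2))"
    by (rule ou_iexp[OF ou' _ _ st]) auto
  also have "(LINT x|M. iexp (\<theta> \<bullet> \<xi> s x) * iexp (?y \<bullet> \<xi> s x)) = (LINT x|M. iexp ((\<theta> + ?y) \<bullet> \<xi> s x))"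
    by (simp add: distrib_left exp_add inner_add_left)
  also have "\<dots> = of_real (exp (- V (\<theta> + ?y) / 2))" by (rule stationary_iexp[OF ou])
  also have "\<dots> * of_real (exp (- (V \<eta> - V ?y) / 2)) = of_real (exp (- V (\<theta> + ?y) / 2 + - (V \<eta> - V ?y) / 2))"
    by (simp only: exp_add of_real_mult)
  also have "- V (\<theta> + ?y) / 2 + - (V \<eta> - V ?y) / 2
      = - (V \<theta> + 2 * (\<theta> \<bullet> (S *v ?y)) + V \<eta>) / 2"
    by (simp add: V_add field_simps)
  finally show ?thesis .
qed

text \<open>Scaling both test vectors by \<open>c\<close> exhibits \<open>U\<close> as a centred
  Gaussian scalar. A zero test vector yields one-time moments, a pair of axes yields
  covariances.\<close>

lemma joint_moments:
  fixes \<theta> \<eta> :: "real^'n"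
  assumes ou: "stationary_ou M F W A \<sigma> \<xi>" and st: "s \<le> t"
  defines "U \<equiv> \<lambda>x. \<theta> \<bullet> \<xi> s x + \<eta> \<bullet> \<xi> t x"
  shows "integrable M U" "(LINT x|M. U x) = 0" "integrable M (\<lambda>x. (U x)\<^sup>2)"
    "(LINT x|M. (U x)\<^sup>2) = V \<theta> + 2 * (\<theta> \<bullet> (S *v flow \<eta> (t - s))) + V \<eta>"
proof -
  have bm: "brownian_motion M F W" using ou unfolding stationary_ou_def ou_process_def by auto
  interpret prob_space M by (rule brownian_motionD[OF bm])
  have m[measurable]: "\<xi> t \<in> borel_measurable M" for t
    using ou measurable_from_subalg[OF brownian_motionD(2)[OF bm]]
    unfolding stationary_ou_def ou_process_def by blast
  let ?v = "V \<theta> + 2 * (\<theta> \<bullet> (S *v flow \<eta> (t - s))) + V \<eta>"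
  have Um: "U \<in> borel_measurable M" unfolding U_def by measurable
  \<comment> \<open>The variance is V (\<theta> + y) + (V \<eta> - V y), and \<open>V\<close> does
    not grow along the flow.\<close>
  have v: "0 \<le> ?v"
    using V_nonneg[of "\<theta> + flow \<eta> (t - s)"] V_flow_le[of "t - s" \<eta>] st by (simp add: V_add)
  have char: "(LINT x|M. iexp (c * U x)) = of_real (exp (- (?v * c\<^sup>2) / 2))" for c
    using joint_iexp[OF ou st, of "c *\<^sub>R \<theta>" "c *\<^sub>R \<eta>"]
    by (simp add: U_def V_scaleR flow_scaleR matrix_vector_mult_scaleR distrib_left power2_eq_square algebra_simps)
  show "integrable M U" "(LINT x|M. U x) = 0" "integrable M (\<lambda>x. (U x)\<^sup>2)" "(LINT x|M. (U x)\<^sup>2) = ?v"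
    by (rule char_gaussian_moments[OF Um v char])+
qed

lemma stationary_square_integrable:
  assumes ou: "stationary_ou M F W A \<sigma> \<xi>"
  shows "square_integrable M (\<xi> t)"
  unfolding square_integrable_def
proof
  have bm: "brownian_motion M F W" using ou unfolding stationary_ou_def ou_process_def by auto
  show "\<xi> t \<in> borel_measurable M"
    using ou measurable_from_subalg[OF brownian_motionD(2)[OF bm]]
    unfolding stationary_ou_def ou_process_def by blast
  have "integrable M (\<lambda>x. (\<xi> t x $ i)\<^sup>2)" for i
    using joint_moments(3)[OF ou order_refl, of 0 t "axis i 1"] by (simp add: inner_axis')
  then show "integrable M (\<lambda>x. (norm (\<xi> t x))\<^sup>2)"
    unfolding power2_norm_eq_inner by (simp add: inner_vec_def power2_eq_square)
qed

text \<open>The coordinates are centred, so polarisation recovers the mean of a b from the second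
  moments of a, b and a + b. The later time is the column index, hence \<open>E\<close> stands to
  the right of \<open>S\<close>.\<close>

lemma stationary_cov:
  assumes ou: "stationary_ou M F W A \<sigma> \<xi>" and st: "s \<le> t"
  shows "cov M (\<xi> s) (\<xi> t) = S ** E (t - s)"
  unfolding vec_eq_iff
proof (intro allI)
  fix i j
  have mean: "(LINT x|M. \<xi> r x $ k) = 0" for r k
    using joint_moments(2)[OF ou order_refl, of 0 r "axis k 1"] by (simp add: inner_axis')
  let ?a = "\<lambda>x. \<xi> s x $ i" and ?b = "\<lambda>x. \<xi> t x $ j"
  note m = joint_moments(3,4)[OF ou st]
  have a: "integrable M (\<lambda>x. (?a x)\<^sup>2)" "(LINT x|M. (?a x)\<^sup>2) = V (axis i 1)"
    using m[of "axis i 1" 0] by (simp_all add: inner_axis' flow_def V_def)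
  have b: "integrable M (\<lambda>x. (?b x)\<^sup>2)" "(LINT x|M. (?b x)\<^sup>2) = V (axis j 1)"
    using m[of 0 "axis j 1"] by (simp_all add: inner_axis' V_def)
  have ab: "integrable M (\<lambda>x. (?a x + ?b x)\<^sup>2)"
    "(LINT x|M. (?a x + ?b x)\<^sup>2) = V (axis i 1) + 2 * (axis i 1 \<bullet> (S *v flow (axis j 1) (t - s))) + V (axis j 1)"
    using m[of "axis i 1" "axis j 1"] by (simp_all add: inner_axis')
  have "cov M (\<xi> s) (\<xi> t) $ i $ j = (LINT x|M. ?a x * ?b x)"
    by (simp add: cov_def mean)
  also have "\<dots> = (LINT x|M. ((?a x + ?b x)\<^sup>2 - (?a x)\<^sup>2 - (?b x)\<^sup>2) / 2)"
    by (rule Bochner_Integration.integral_cong) (simp_all add: power2_sum)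
  also have "\<dots> = axis i 1 \<bullet> (S *v flow (axis j 1) (t - s))"
    using a b ab by simp
  also have "\<dots> = (S ** E (t - s)) $ i $ j"
    unfolding flow_def matrix_vector_mul_assoc matrix_vector_mult_basis
    by (simp add: inner_axis' column_def matrix_matrix_mult_def matrix_vector_mult_def)
  finally show "cov M (\<xi> s) (\<xi> t) $ i $ j = (S ** E (t - s)) $ i $ j" .
qed

section \<open>Integration of the autocovariance over all lags\<close>

lemma bounded_linear_matrix_mult: "bounded_linear (\<lambda>X::real^'n^'n. N ** X)" for N :: "real^'n^'n"
  by (intro linear_conv_bounded_linear[THEN iffD1] linearI)
    (simp_all add: matrix_matrix_mult_def vec_eq_iff sum.distrib sum_distrib_left algebra_simps)

lemma bounded_linear_transpose: "bounded_linear (transpose :: real^'n^'n \<Rightarrow> _)"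
  by (intro linear_conv_bounded_linear[THEN iffD1] linearI)
    (simp_all add: transpose_def vec_eq_iff)

lemma E_decay: "\<exists>K\<ge>0. \<exists>c>0. \<forall>t\<ge>0. norm (E t) \<le> K * exp (- c * t)"
proof -
  obtain K c where K: "K \<ge> 0" "c > 0" "\<And>\<eta> t. t \<ge> 0 \<Longrightarrow> norm (flow \<eta> t) \<le> K * exp (- c * t) * norm \<eta>"
    using flow_decay by blast
  let ?N = "real CARD('n)"
  have "norm (E t) \<le> (?N * ?N * K) * exp (- c * t)" if "t \<ge> 0" for t
  proof -
    have "\<bar>E t $ i $ j\<bar> \<le> K * exp (- c * t)" for i j
    proof -
      have "\<bar>E t $ i $ j\<bar> = \<bar>flow (axis j 1) t $ i\<bar>"
        by (simp add: flow_def matrix_vector_mult_basis column_def)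
      also have "\<dots> \<le> norm (flow (axis j 1) t)" by (rule component_le_norm_cart)
      also have "\<dots> \<le> K * exp (- c * t)" using K(3)[OF that, of "axis j 1"] by simp
      finally show ?thesis .
    qed
    then have "(\<Sum>i\<in>UNIV. \<Sum>j\<in>UNIV. \<bar>E t $ i $ j\<bar>) \<le> (\<Sum>i\<in>(UNIV::'n set). \<Sum>j\<in>(UNIV::'n set). K * exp (- c * t))"
      by (intro sum_mono)
    with norm_matrix_le_sum[of "E t"] show ?thesis by (simp add: mult_ac)
  qed
  then show ?thesis using K(1,2) by (intro exI[of _ "?N * ?N * K"] conjI exI[of _ c]) auto
qed

text \<open>Since \<open>J\<close> inverts A^T, the derivative of S J E is S J A^T E = S E. The
  boundary values are S J at 0 and 0 at infinity.\<close>

lemma integral_S_E: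
  assumes J: "J ** transpose A = mat 1"
  defines "f \<equiv> \<lambda>\<tau>. indicator {0<..} \<tau> *\<^sub>R (S ** E \<tau>)"
  shows "integrable lborel f" "(LINT \<tau>|lborel. f \<tau>) = - (S ** J)"
proof -
  obtain K c where K: "K \<ge> 0" "c > 0" "\<And>t. t \<ge> 0 \<Longrightarrow> norm (E t) \<le> K * exp (- c * t)"
    using E_decay by blast
  obtain L where L: "L > 0" "\<And>X::real^'n^'n. norm (S ** X) \<le> L * norm X"
    using bounded_linear.pos_bounded[OF bounded_linear_matrix_mult[of S]] by (auto simp: mult.commute)
  have lim0: "((\<lambda>t. exp (- c * t)) \<longlongrightarrow> 0) at_top"
    by (intro filterlim_compose[OF exp_at_bot] filterlim_tendsto_neg_mult_at_bot[OF tendsto_const]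
        filterlim_ident) (use K in simp)
  have Econt: "isCont E t" for t by (rule has_vector_derivative_continuous[OF E_deriv])
  have SEcont: "isCont (\<lambda>t. S ** E t) t" for t
    by (rule bounded_linear.isCont[OF bounded_linear_matrix_mult Econt])
  have exp_int: "set_integrable lborel (einterval 0 \<infinity>) (\<lambda>t. exp (- c * t))"
  proof (rule interval_integral_FTC_nonneg(1)[where F="\<lambda>t. - exp (- c * t) / c" and A="- 1 / c" and B=0])
    show "(((\<lambda>t. - exp (- c * t) / c) \<circ> real_of_ereal) \<longlongrightarrow> - 1 / c) (at_right 0)"
    proof -
      have "((\<lambda>t. - exp (- c * t) / c) \<longlongrightarrow> - exp (- c * 0) / c) (at_right 0)"
        by (intro tendsto_intros) (use K in simp)
      then show ?thesis unfolding zero_ereal_def ereal_tendsto_simps by simp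
    qed
    show "(((\<lambda>t. - exp (- c * t) / c) \<circ> real_of_ereal) \<longlongrightarrow> 0) (at_left \<infinity>)"
      unfolding ereal_tendsto_simps using tendsto_divide[OF tendsto_minus[OF lim0] tendsto_const, of c] K by simp
  qed (use K in \<open>auto intro!: derivative_eq_intros\<close>)
  have einf: "einterval 0 \<infinity> = {0<..}" by (auto simp: einterval_def)
  have ind: "f = (\<lambda>\<tau>. indicator (einterval 0 \<infinity>) \<tau> *\<^sub>R (S ** E \<tau>))" by (simp add: f_def einf)
  have meas: "(\<lambda>t. S ** E t) \<in> borel_measurable borel"
    using SEcont by (intro borel_measurable_continuous_onI continuous_at_imp_continuous_on) auto
  show int: "integrable lborel f"
  proof (rule Bochner_Integration.integrable_bound)
    show "integrable lborel (\<lambda>\<tau>. L * K * (indicator {0<..} \<tau> *\<^sub>R exp (- c * \<tau>)))"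
      using exp_int unfolding set_integrable_def einf by (intro integrable_mult_right)
    show "f \<in> borel_measurable lborel" unfolding f_def using meas by measurable
    show "AE \<tau> in lborel. norm (f \<tau>) \<le> norm (L * K * (indicator {0<..} \<tau> *\<^sub>R exp (- c * \<tau>)))"
    proof (intro AE_I2)
      fix \<tau> :: real
      have "norm (S ** E \<tau>) \<le> L * (K * exp (- c * \<tau>))" if "\<tau> > 0"
        using L(2)[of "E \<tau>"] mult_left_mono[OF K(3), of \<tau> L] that L(1)
        by (meson less_imp_le order_trans)
      then show "norm (f \<tau>) \<le> norm (L * K * (indicator {0<..} \<tau> *\<^sub>R exp (- c * \<tau>)))"
        using L(1) K(1) by (auto simp: f_def indicator_def abs_mult mult_ac)
    qed
  qed
  have "(LBINT \<tau>=0..\<infinity>. S ** E \<tau>) = 0 - (S ** J)"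
  proof (rule interval_integral_FTC_integrable[where F="\<lambda>\<tau>. (S ** J) ** E \<tau>"])
    show "((\<lambda>\<tau>. (S ** J) ** E \<tau>) has_vector_derivative S ** E \<tau>) (at \<tau>)" for \<tau>
      using bounded_linear.has_vector_derivative[OF bounded_linear_matrix_mult E_deriv, of "S ** J" \<tau>] J
      by (simp add: matrix_mul_assoc[symmetric]) (simp add: matrix_mul_assoc)
    show "set_integrable lborel (einterval 0 \<infinity>) (\<lambda>\<tau>. S ** E \<tau>)"
      using int unfolding ind set_integrable_def .
    have "((\<lambda>\<tau>. (S ** J) ** E \<tau>) \<longlongrightarrow> (S ** J) ** E 0) (at_right 0)"
      by (intro bounded_linear.tendsto[OF bounded_linear_matrix_mult] tendsto_within_subset[OF Econt[unfolded isCont_def]]) simp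
    then show "(((\<lambda>\<tau>. (S ** J) ** E \<tau>) \<circ> real_of_ereal) \<longlongrightarrow> S ** J) (at_right 0)"
      unfolding zero_ereal_def ereal_tendsto_simps by (simp add: E0)
    have "(E \<longlongrightarrow> 0) at_top"
    proof (rule Lim_null_comparison)
      show "\<forall>\<^sub>F t in at_top. norm (E t) \<le> K * exp (- c * t)"
        using eventually_ge_at_top[of 0] by eventually_elim (rule K(3))
      show "((\<lambda>t. K * exp (- c * t)) \<longlongrightarrow> 0) at_top"
        using tendsto_mult[OF tendsto_const lim0, of K] by simp
    qed
    then have "((\<lambda>\<tau>. (S ** J) ** E \<tau>) \<longlongrightarrow> (S ** J) ** 0) at_top"
      by (intro bounded_linear.tendsto[OF bounded_linear_matrix_mult])
    then show "(((\<lambda>\<tau>. (S ** J) ** E \<tau>) \<circ> real_of_ereal) \<longlongrightarrow> 0) (at_left \<infinity>)"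
      unfolding ereal_tendsto_simps by simp
  qed (use SEcont in auto)
  then show "(LINT \<tau>|lborel. f \<tau>) = - (S ** J)"
    unfolding ind by (simp add: interval_lebesgue_integral_def set_lebesgue_integral_def)
qed

lemma cov_transpose: "cov M X Y = transpose (cov M Y X)"
  by (simp add: cov_def transpose_def vec_eq_iff mult.commute)

text \<open>Negative lags give the transposes of the autocovariances at the reflected positive lags,
  so the integral is one half-line integral plus its transpose.\<close>

lemma long_run_cov_stationary_ou:
  assumes ou: "stationary_ou M F W A \<sigma> \<xi>" and R: "R ** (- A) = mat 1" "(- A) ** R = mat 1"
  shows "integrable lborel (\<lambda>\<tau>. cov M (\<xi> 0) (\<xi> \<tau>))"
    "long_run_cov M \<xi> = R ** S + S ** transpose R"
proof -
  have tS: "transpose S = S" using S by (simp add: sym_pos_def_def)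
  define f where "f \<tau> = indicator {0<..} \<tau> *\<^sub>R (S ** E \<tau>)" for \<tau> :: real
  have neg: "(- X) ** Y = - (X ** Y)" "X ** (- Y) = - (X ** Y)" for X Y :: "real^'n^'n"
    by (simp_all add: matrix_matrix_mult_def vec_eq_iff sum_negf)
  have "transpose ((- A) ** R) = mat 1" using R by (simp add: transpose_mat)
  then have "transpose R ** transpose (- A) = mat 1" by (simp add: matrix_transpose_mul)
  moreover have "transpose (- A) = - transpose A" by (simp add: transpose_def vec_eq_iff)
  \<comment> \<open>This supplies the left inverse \<open>J\<close> of A^T for
    \<open>integral_S_E\<close>.\<close>
  ultimately have "(- transpose R) ** transpose A = mat 1" by (simp add: neg)
  note f = integral_S_E[OF this, folded f_def]
  have f2: "(LINT \<tau>|lborel. f \<tau>) = S ** transpose R" using f(2) by (simp add: neg)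
  have g: "integrable lborel (\<lambda>\<tau>. f (- \<tau>))" "(LINT \<tau>|lborel. f (- \<tau>)) = (LINT \<tau>|lborel. f \<tau>)"
    using lborel_integrable_real_affine[OF f(1), of "-1" 0] lborel_integral_real_affine[of "-1" f 0] by simp_all
  have tg: "integrable lborel (\<lambda>\<tau>. transpose (f (- \<tau>)))"
    "(LINT \<tau>|lborel. transpose (f (- \<tau>))) = transpose (LINT \<tau>|lborel. f \<tau>)"
    using integrable_bounded_linear[OF bounded_linear_transpose g(1)]
      integral_bounded_linear[OF bounded_linear_transpose g(1)] g(2) by simp_all
  \<comment> \<open>The open half-lines miss lag 0, where the autocovariance is \<open>S\<close>;
    this single point has measure zero.\<close>
  have z: "integrable lborel (\<lambda>\<tau>. indicator {0::real} \<tau> *\<^sub>R S)" "(LINT \<tau>|lborel. indicator {0::real} \<tau> *\<^sub>R S) = 0"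
    by simp_all
  have eq: "(\<lambda>\<tau>. cov M (\<xi> 0) (\<xi> \<tau>)) = (\<lambda>\<tau>. f \<tau> + transpose (f (- \<tau>)) + indicator {0} \<tau> *\<^sub>R S)"
  proof
    fix \<tau> :: real
    consider "\<tau> > 0" | "\<tau> = 0" | "\<tau> < 0" by linarith
    then show "cov M (\<xi> 0) (\<xi> \<tau>) = f \<tau> + transpose (f (- \<tau>)) + indicator {0} \<tau> *\<^sub>R S"
    proof cases
      case 3
      then show ?thesis
        using stationary_cov[OF ou, of \<tau> 0] cov_transpose[of M "\<xi> 0" "\<xi> \<tau>"] by (simp add: f_def)
    qed (use stationary_cov[OF ou, of 0 \<tau>] E0 in \<open>simp_all add: f_def transpose_def vec_eq_iff\<close>)
  qed
  show "integrable lborel (\<lambda>\<tau>. cov M (\<xi> 0) (\<xi> \<tau>))"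
    unfolding eq using f(1) tg(1) z(1) by (intro Bochner_Integration.integrable_add)
  have "long_run_cov M \<xi> = S ** transpose R + transpose (S ** transpose R)"
    unfolding long_run_cov_def eq using f(1) f2 tg z by simp
  also have "\<dots> = R ** S + S ** transpose R"
    by (simp add: matrix_transpose_mul tS add.commute)
  finally show "long_run_cov M \<xi> = R ** S + S ** transpose R" .
qed

end

subsection \<open>The droop-controlled inverter\<close>

lemma matrix2_nth [simp]:
  "matrix2 a b c d $ 1 $ 1 = a" "matrix2 a b c d $ 1 $ 2 = b"
  "matrix2 a b c d $ 2 $ 1 = c" "matrix2 a b c d $ 2 $ 2 = d"
  by (simp_all add: matrix2_def)

lemma matrix2_eq_iff:
  "M = matrix2 a b c d \<longleftrightarrow> M $ 1 $ 1 = a \<and> M $ 1 $ 2 = b \<and> M $ 2 $ 1 = c \<and> M $ 2 $ 2 = d"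
  by (auto simp: vec_eq_iff forall_2)

lemma matrix2_eta: "M = matrix2 (M $ 1 $ 1) (M $ 1 $ 2) (M $ 2 $ 1) (M $ 2 $ 2)"
  by (simp add: matrix2_eq_iff)

lemma matrix2_ops:
  fixes a b c d a' b' c' d' r :: real
  shows "matrix2 a b c d ** matrix2 a' b' c' d'
      = matrix2 (a * a' + b * c') (a * b' + b * d') (c * a' + d * c') (c * b' + d * d')"
    and "matrix2 a b c d + matrix2 a' b' c' d' = matrix2 (a + a') (b + b') (c + c') (d + d')"
    and "matrix2 a b c d - matrix2 a' b' c' d' = matrix2 (a - a') (b - b') (c - c') (d - d')"
    and "- matrix2 a b c d = matrix2 (- a) (- b) (- c) (- d)"
    and "r *\<^sub>R matrix2 a b c d = matrix2 (r * a) (r * b) (r * c) (r * d)"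
    and "transpose (matrix2 a b c d) = matrix2 a c b d"
    and "mat 1 = matrix2 (1::real) 0 0 1"
    and "0 = matrix2 (0::real) 0 0 0"
  by (simp_all add: matrix2_eq_iff matrix_matrix_mult_def sum_2 transpose_def mat_def)

lemma norm_matrix2_le: "norm (matrix2 a b c d :: real^2^2) \<le> \<bar>a\<bar> + \<bar>b\<bar> + \<bar>c\<bar> + \<bar>d\<bar>"
  using norm_matrix_le_sum[of "matrix2 a b c d"] by (simp add: sum_2)

text \<open>Sylvester's criterion in dimension two, by completing the square after multiplication by
  a > 0.\<close>

lemma sym_pos_def_matrix2:
  assumes "a > 0" "a * c - b\<^sup>2 > 0"
  shows "sym_pos_def (matrix2 a b b c :: real^2^2)"
  unfolding sym_pos_def_def
proof (intro conjI allI impI)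
  fix x :: "real^2" assume x: "x \<noteq> 0"
  have "a * (x \<bullet> (matrix2 a b b c *v x)) = (a * x $ 1 + b * x $ 2)\<^sup>2 + (a * c - b\<^sup>2) * (x $ 2)\<^sup>2"
    by (simp add: inner_vec_def matrix_vector_mult_def sum_2 power2_eq_square algebra_simps)
  also have "\<dots> > 0"
  proof (cases "x $ 2 = 0")
    case True
    then have "x $ 1 \<noteq> 0" using x by (auto simp: vec_eq_iff forall_2)
    then show ?thesis using True assms by simp
  qed (use assms in \<open>intro add_nonneg_pos; simp\<close>)
  finally show "x \<bullet> (matrix2 a b b c *v x) > 0" using assms by (simp add: zero_less_mult_iff)
qed (simp add: matrix2_ops)

lemma real_matrix_add_rdistrib: "(B + C) ** A = (B ** A) + (C ** A)" for A B C :: "real^'n^'n"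
  by (simp add: matrix_matrix_mult_def vec_eq_iff distrib_right sum.distrib)

lemma matrix_inv_eqI:
  fixes X Y :: "real^'n^'n"
  assumes "X ** Y = mat 1" "Y ** X = mat 1"
  shows "matrix_inv X = Y"
proof -
  have "X ** matrix_inv X = mat 1 \<and> matrix_inv X ** X = mat 1"
    unfolding matrix_inv_def by (rule someI[of _ Y]) (use assms in simp)
  then have "matrix_inv X ** X ** Y = Y" by simp
  then show ?thesis using assms by (simp add: matrix_mul_assoc[symmetric])
qed

text \<open>Minus the trace and the determinant of the drift are \<open>s\<close> and \<Delta>. The
  characteristic polynomial l^2 + s l + \<Delta> annihilates both components of an eigenvector, and
  its positive coefficients exclude roots with Re l \<ge> 0.\<close>

lemma hurwitz_drift:
  assumes "\<omega>f > 0" "\<omega>v > 0" "kP \<ge> 0" "kQ \<ge> 0"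
  shows "hurwitz (drift \<omega>f \<omega>v kP kQ)"
  unfolding hurwitz_def
proof (intro allI impI, elim conjE)
  fix l :: complex and v :: "complex^2"
  assume v: "v \<noteq> 0" and eig: "map_matrix complex_of_real (drift \<omega>f \<omega>v kP kQ) *v v = l *s v"
  define s where "s = \<omega>f + \<omega>v"
  define \<Delta> where "\<Delta> = \<omega>f * \<omega>v * (1 + kP * kQ)"
  have pos: "s > 0" "\<Delta> > 0" using assms by (simp_all add: s_def \<Delta>_def add_pos_nonneg)
  have e1: "(l + \<omega>f) * v $ 1 = kP * \<omega>f * v $ 2" and e2: "(l + \<omega>v) * v $ 2 = - (kQ * \<omega>v) * v $ 1"
  proof -
    have "- \<omega>f * v $ 1 + kP * \<omega>f * v $ 2 = l * v $ 1" "- (kQ * \<omega>v) * v $ 1 + - \<omega>v * v $ 2 = l * v $ 2"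
      using arg_cong[OF eig, of "\<lambda>x. x $ 1"] arg_cong[OF eig, of "\<lambda>x. x $ 2"]
      by (simp_all add: matrix_vector_mult_def sum_2 map_matrix_def drift_def)
    note eqs = this[unfolded of_real_minus]
    show "(l + \<omega>f) * v $ 1 = kP * \<omega>f * v $ 2"
      using eqs(1) by algebra
    show "(l + \<omega>v) * v $ 2 = - (kQ * \<omega>v) * v $ 1"
      unfolding of_real_minus using eqs(2) by algebra
  qed
  have p1: "(l\<^sup>2 + s * l + \<Delta>) * v $ 1 = 0"
  proof -
    have "(l\<^sup>2 + s * l + \<Delta>) * v $ 1 = (l + \<omega>v) * ((l + \<omega>f) * v $ 1) + kP * kQ * \<omega>f * \<omega>v * v $ 1"
      by (simp add: s_def \<Delta>_def power2_eq_square algebra_simps)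
    also have "\<dots> = kP * \<omega>f * ((l + \<omega>v) * v $ 2) + kP * kQ * \<omega>f * \<omega>v * v $ 1"
      unfolding e1 by (simp add: algebra_simps)
    also have "\<dots> = 0" unfolding e2 by (simp add: algebra_simps)
    finally show ?thesis .
  qed
  have p2: "(l\<^sup>2 + s * l + \<Delta>) * v $ 2 = 0"
  proof -
    have "(l\<^sup>2 + s * l + \<Delta>) * v $ 2 = (l + \<omega>f) * ((l + \<omega>v) * v $ 2) + kP * kQ * \<omega>f * \<omega>v * v $ 2"
      by (simp add: s_def \<Delta>_def power2_eq_square algebra_simps)
    also have "\<dots> = - kQ * \<omega>v * ((l + \<omega>f) * v $ 1) + kP * kQ * \<omega>f * \<omega>v * v $ 2"
      unfolding e2 by (simp add: algebra_simps)
    also have "\<dots> = 0" unfolding e1 by (simp add: algebra_simps)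
    finally show ?thesis .
  qed
  have "l\<^sup>2 + s * l + \<Delta> = 0"
    using p1 p2 v by (auto simp: vec_eq_iff forall_2)
  from arg_cong[OF this, of Re] arg_cong[OF this, of Im]
  have re: "(Re l)\<^sup>2 - (Im l)\<^sup>2 + s * Re l + \<Delta> = 0" and im: "Im l * (2 * Re l + s) = 0"
    by (simp_all add: power2_eq_square distrib_left mult_ac)
  show "Re l < 0"
  proof (rule ccontr)
    assume "\<not> Re l < 0"
    then have "Re l \<ge> 0" by simp
    then have "Im l = 0" using im pos by simp
    then have "(Re l)\<^sup>2 + s * Re l + \<Delta> = 0" using re by simp
    moreover have "(Re l)\<^sup>2 + s * Re l + \<Delta> > 0"
      using \<open>Re l \<ge> 0\<close> pos by (intro add_nonneg_pos) auto
    ultimately show False by simp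
  qed
qed

section \<open>Closed form of the instantaneous covariance\<close>

lemma lyapunov_drift_iff:
  "lyapunov (drift \<omega>f \<omega>v kP kQ) \<sigma> (matrix2 a b b c) \<longleftrightarrow>
     2 * \<omega>f * a - 2 * kP * \<omega>f * b = \<sigma>\<^sup>2 \<and> kQ * \<omega>v * a + (\<omega>f + \<omega>v) * b - kP * \<omega>f * c = 0
     \<and> 2 * kQ * \<omega>v * b + 2 * \<omega>v * c = \<sigma>\<^sup>2"
  unfolding lyapunov_def drift_def matrix2_ops
  by (auto simp: matrix2_eq_iff algebra_simps)

text \<open>\<open>s\<close> and \<Delta> are parameters tied down by equations, so the closed forms
  can be instantiated at the baseline values, at zero coupling and at varying gains.\<close>

locale droop =
  fixes \<omega>f \<omega>v kP kQ \<sigma> s \<Delta> :: real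
  assumes pos: "\<omega>f > 0" "\<omega>v > 0" "kP \<ge> 0" "kQ \<ge> 0" "\<sigma> > 0"
    and s_eq: "s = \<omega>f + \<omega>v" and \<Delta>_eq: "\<Delta> = \<omega>f * \<omega>v * (1 + kP * kQ)"
begin

abbreviation "A \<equiv> drift \<omega>f \<omega>v kP kQ"

lemma s_pos: "s > 0" and \<Delta>_pos: "\<Delta> > 0"
  using pos by (simp_all add: s_eq \<Delta>_eq add_pos_nonneg)

text \<open>The off-diagonal entry is eliminated first; the first and third equations then give the
  diagonal. They determine \<omega>f a and \<omega>v c, hence the extra factors that are cancelled
  at the end.\<close>

lemma lyapunov_unique:
  assumes "lyapunov A \<sigma> (matrix2 a b b c)"
  shows "a = \<sigma>\<^sup>2 / (2 * \<Delta> * s) * (\<omega>v * s + kP\<^sup>2 * \<omega>f\<^sup>2 + kP * kQ * \<omega>f * \<omega>v)"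
    "b = \<sigma>\<^sup>2 / (2 * \<Delta> * s) * (kP * \<omega>f\<^sup>2 - kQ * \<omega>v\<^sup>2)"
    "c = \<sigma>\<^sup>2 / (2 * \<Delta> * s) * (\<omega>f * s + kQ\<^sup>2 * \<omega>v\<^sup>2 + kP * kQ * \<omega>f * \<omega>v)"
proof -
  have e: "2 * \<omega>f * a - 2 * kP * \<omega>f * b = \<sigma>\<^sup>2" "kQ * \<omega>v * a + (\<omega>f + \<omega>v) * b - kP * \<omega>f * c = 0"
     "2 * kQ * \<omega>v * b + 2 * \<omega>v * c = \<sigma>\<^sup>2"
    using assms by (auto simp: lyapunov_drift_iff)
  have nz: "2 * \<Delta> * s \<noteq> 0" "\<omega>f \<noteq> 0" "\<omega>v \<noteq> 0" using s_pos \<Delta>_pos pos by auto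
  have b: "2 * \<Delta> * s * b = \<sigma>\<^sup>2 * (kP * \<omega>f\<^sup>2 - kQ * \<omega>v\<^sup>2)"
    using e unfolding s_eq \<Delta>_eq by algebra
  then show "b = \<sigma>\<^sup>2 / (2 * \<Delta> * s) * (kP * \<omega>f\<^sup>2 - kQ * \<omega>v\<^sup>2)"
    using nz by (simp add: field_simps)
  have "\<omega>f * (2 * \<Delta> * s * a) = \<omega>f * (\<sigma>\<^sup>2 * (\<omega>v * s + kP\<^sup>2 * \<omega>f\<^sup>2 + kP * kQ * \<omega>f * \<omega>v))"
    using e(1) b unfolding s_eq \<Delta>_eq by algebra
  then show "a = \<sigma>\<^sup>2 / (2 * \<Delta> * s) * (\<omega>v * s + kP\<^sup>2 * \<omega>f\<^sup>2 + kP * kQ * \<omega>f * \<omega>v)"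
    using nz by (auto simp: eq_divide_eq mult_ac)
  have "\<omega>v * (2 * \<Delta> * s * c) = \<omega>v * (\<sigma>\<^sup>2 * (\<omega>f * s + kQ\<^sup>2 * \<omega>v\<^sup>2 + kP * kQ * \<omega>f * \<omega>v))"
    using e(3) b unfolding s_eq \<Delta>_eq by algebra
  then show "c = \<sigma>\<^sup>2 / (2 * \<Delta> * s) * (\<omega>f * s + kQ\<^sup>2 * \<omega>v\<^sup>2 + kP * kQ * \<omega>f * \<omega>v)"
    using nz by (auto simp: eq_divide_eq mult_ac)
qed

definition cov_matrix :: "real^2^2" where
  "cov_matrix = (\<sigma>\<^sup>2 / (2 * \<Delta> * s)) *\<^sub>R
           matrix2 (\<omega>v * s + kP\<^sup>2 * \<omega>f\<^sup>2 + kP * kQ * \<omega>f * \<omega>v) (kP * \<omega>f\<^sup>2 - kQ * \<omega>v\<^sup>2)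
                   (kP * \<omega>f\<^sup>2 - kQ * \<omega>v\<^sup>2) (\<omega>f * s + kQ\<^sup>2 * \<omega>v\<^sup>2 + kP * kQ * \<omega>f * \<omega>v)"

lemma lyapunov_cov_matrix: "lyapunov A \<sigma> cov_matrix"
proof -
  \<comment> \<open>Naming the prefactor leaves one polynomial relation, from which the three
    equations follow as polynomial identities.\<close>
  define r where "r = \<sigma>\<^sup>2 / (2 * \<Delta> * s)"
  have r: "r * (2 * \<Delta> * s) = \<sigma>\<^sup>2" using s_pos \<Delta>_pos by (simp add: r_def)
  show ?thesis
    unfolding cov_matrix_def matrix2_ops lyapunov_drift_iff r_def[symmetric]
    using r unfolding s_eq \<Delta>_eq by (intro conjI) algebra+
qed

lemma sym_pos_def_cov_matrix: "sym_pos_def cov_matrix"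
proof -
  define r where "r = \<sigma>\<^sup>2 / (2 * \<Delta> * s)"
  have r: "r > 0" using s_pos \<Delta>_pos pos by (simp add: r_def)
  let ?a = "\<omega>v * s + kP\<^sup>2 * \<omega>f\<^sup>2 + kP * kQ * \<omega>f * \<omega>v"
    and ?b = "kP * \<omega>f\<^sup>2 - kQ * \<omega>v\<^sup>2"
    and ?c = "\<omega>f * s + kQ\<^sup>2 * \<omega>v\<^sup>2 + kP * kQ * \<omega>f * \<omega>v"
  have nn: "0 \<le> kP * kQ * \<omega>f * \<omega>v" using pos by simp
  have a: "?a > 0" using pos s_pos nn by (intro add_pos_nonneg) auto
  \<comment> \<open>The determinant is \<Delta> times a sum of squares, hence visibly
    positive.\<close>
  have "?a * ?c - ?b\<^sup>2 = \<Delta> * (s\<^sup>2 + (kP * \<omega>f + kQ * \<omega>v)\<^sup>2)"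
    unfolding s_eq \<Delta>_eq by algebra
  also have "\<dots> > 0" using s_pos \<Delta>_pos by (intro mult_pos_pos add_pos_nonneg) auto
  finally have d: "?a * ?c - ?b\<^sup>2 > 0" .
  have "r * ?a > 0" using r a by simp
  moreover have "(r * ?a) * (r * ?c) - (r * ?b)\<^sup>2 = r\<^sup>2 * (?a * ?c - ?b\<^sup>2)" by algebra
  then have "(r * ?a) * (r * ?c) - (r * ?b)\<^sup>2 > 0" using r d by simp
  ultimately show ?thesis
    unfolding cov_matrix_def r_def[symmetric] matrix2_ops by (rule sym_pos_def_matrix2)
qed

lemma cov_matrix_unique:
  assumes "sym_pos_def S" "lyapunov A \<sigma> S"
  shows "S = cov_matrix"
proof -
  have "transpose S = S" using assms by (simp add: sym_pos_def_def)
  from arg_cong[OF this, of "\<lambda>M. M $ 1 $ 2"] have "S $ 2 $ 1 = S $ 1 $ 2" by (simp add: transpose_def)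
  then have S: "S = matrix2 (S $ 1 $ 1) (S $ 1 $ 2) (S $ 1 $ 2) (S $ 2 $ 2)"
    using matrix2_eta[of S] by simp
  have "lyapunov A \<sigma> (matrix2 (S $ 1 $ 1) (S $ 1 $ 2) (S $ 1 $ 2) (S $ 2 $ 2))"
    using assms(2) S by simp
  from lyapunov_unique[OF this] show ?thesis
    by (subst S) (simp only: cov_matrix_def matrix2_ops)
qed

lemma ex1_lyapunov: "\<exists>!S. sym_pos_def S \<and> lyapunov A \<sigma> S"
  using lyapunov_cov_matrix sym_pos_def_cov_matrix cov_matrix_unique by blast

lemma inst_cov_eq: "inst_cov A \<sigma> = cov_matrix"
  unfolding inst_cov_def
  using lyapunov_cov_matrix sym_pos_def_cov_matrix cov_matrix_unique by (intro the_equality) blast+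

text \<open>The adjugate of \<open>- A\<close> divided by its determinant, which is
  \<Delta>.\<close>

definition neg_drift_inv :: "real^2^2" where
  "neg_drift_inv = matrix2 (\<omega>v / \<Delta>) (kP * \<omega>f / \<Delta>) (- (kQ * \<omega>v) / \<Delta>) (\<omega>f / \<Delta>)"

lemma neg_drift_inv: "neg_drift_inv ** (- A) = mat 1" "(- A) ** neg_drift_inv = mat 1"
proof -
  define d where "d = inverse \<Delta>"
  have inv: "d * (\<omega>f * \<omega>v * (1 + kP * kQ)) = 1"
    using \<Delta>_pos by (simp add: d_def flip: \<Delta>_eq)
  show "neg_drift_inv ** (- A) = mat 1"
    unfolding neg_drift_inv_def drift_def matrix2_ops matrix2_eq_iff matrix2_nth divide_inverse d_def[symmetric]
    using inv by (intro conjI) (algebra | simp add: algebra_simps)+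
  show "(- A) ** neg_drift_inv = mat 1"
    unfolding neg_drift_inv_def drift_def matrix2_ops matrix2_eq_iff matrix2_nth divide_inverse d_def[symmetric]
    using inv by (intro conjI) (algebra | simp add: algebra_simps)+
qed

lemma invertible_neg_drift: "invertible (- A)"
  unfolding invertible_def using neg_drift_inv by blast

lemma matrix_inv_neg_drift: "matrix_inv (- A) = neg_drift_inv"
  by (rule matrix_inv_eqI) (rule neg_drift_inv(2), rule neg_drift_inv(1))

lemma exists_matrix_flow: "\<exists>E. matrix_flow A \<sigma> cov_matrix E"
  using exists_matrix_exp[of "transpose A"] pos(5) sym_pos_def_cov_matrix lyapunov_cov_matrix
  unfolding matrix_flow_def by blast

lemma stationary_ou_cov:
  assumes "stationary_ou M F W A \<sigma> \<xi>"
  shows "square_integrable M (\<xi> t)" "cov M (\<xi> t) (\<xi> t) = cov_matrix"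
    "integrable lborel (\<lambda>\<tau>. cov M (\<xi> 0) (\<xi> \<tau>))"
    "long_run_cov M \<xi> = neg_drift_inv ** cov_matrix + cov_matrix ** transpose neg_drift_inv"
proof -
  obtain E where "matrix_flow A \<sigma> cov_matrix E" using exists_matrix_flow by blast
  then interpret matrix_flow A \<sigma> cov_matrix E .
  show "square_integrable M (\<xi> t)" by (rule stationary_square_integrable[OF assms])
  show "cov M (\<xi> t) (\<xi> t) = cov_matrix" using stationary_cov[OF assms order_refl, of t] E0 by simp
  show "integrable lborel (\<lambda>\<tau>. cov M (\<xi> 0) (\<xi> \<tau>))"
    "long_run_cov M \<xi> = neg_drift_inv ** cov_matrix + cov_matrix ** transpose neg_drift_inv"
    by (rule long_run_cov_stationary_ou[OF assms neg_drift_inv])+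
qed

text \<open>Multiplying the Lyapunov equation by the inverse drift on the left and by its transpose
  on the right collapses the long-run covariance to \<open>\<sigma>\<^sup>2 A\<inverse> (A\<inverse>)\<^sup>T\<close>.\<close>
lemma long_run_formula:
  "neg_drift_inv ** cov_matrix + cov_matrix ** transpose neg_drift_inv = (\<sigma>\<^sup>2 / \<Delta>\<^sup>2) *\<^sub>R
     matrix2 (\<omega>v\<^sup>2 + kP\<^sup>2 * \<omega>f\<^sup>2) (kP * \<omega>f\<^sup>2 - kQ * \<omega>v\<^sup>2) (kP * \<omega>f\<^sup>2 - kQ * \<omega>v\<^sup>2) (\<omega>f\<^sup>2 + kQ\<^sup>2 * \<omega>v\<^sup>2)"
  (is "?L = ?R")
proof -
  let ?G = neg_drift_inv and ?N = "- A"
  have "transpose A = - transpose ?N" by (simp add: transpose_def vec_eq_iff)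
  then have "?N ** cov_matrix + cov_matrix ** transpose ?N = \<sigma>\<^sup>2 *\<^sub>R mat 1"
    using lyapunov_cov_matrix unfolding lyapunov_def
    by (simp add: matrix_matrix_mult_def vec_eq_iff sum_negf) (simp add: algebra_simps)
  then have "?G ** (?N ** cov_matrix + cov_matrix ** transpose ?N) ** transpose ?G
      = ?G ** (\<sigma>\<^sup>2 *\<^sub>R mat 1) ** transpose ?G" by simp
  moreover have "transpose ?N ** transpose ?G = mat 1"
    using neg_drift_inv(1) by (simp add: matrix_transpose_mul[symmetric] transpose_mat)
  then have "?G ** (?N ** cov_matrix + cov_matrix ** transpose ?N) ** transpose ?G = ?L"
    by (simp add: matrix_add_ldistrib real_matrix_add_rdistrib matrix_mul_assoc neg_drift_inv add.commute)
      (simp add: matrix_mul_assoc[symmetric])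
  moreover have "?G ** (\<sigma>\<^sup>2 *\<^sub>R mat 1) ** transpose ?G = ?R"
    unfolding neg_drift_inv_def matrix2_ops by (simp add: matrix2_eq_iff power2_eq_square add_divide_distrib diff_divide_distrib algebra_simps)
  ultimately show ?thesis by simp
qed

end

section \<open>Inverse and small-coupling limit of the long-run covariance\<close>

context droop
begin

definition long_run :: "real^2^2" where
  "long_run = (\<sigma>\<^sup>2 / \<Delta>\<^sup>2) *\<^sub>R
     matrix2 (\<omega>v\<^sup>2 + kP\<^sup>2 * \<omega>f\<^sup>2) (kP * \<omega>f\<^sup>2 - kQ * \<omega>v\<^sup>2) (kP * \<omega>f\<^sup>2 - kQ * \<omega>v\<^sup>2) (\<omega>f\<^sup>2 + kQ\<^sup>2 * \<omega>v\<^sup>2)"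

text \<open>The \<open>matrix2\<close> part of \<open>long_run\<close> has determinant \<Delta>^2,
  which cancels the denominator, so the inverse is polynomial in the gains.\<close>

lemma matrix_inv_long_run:
  "invertible long_run"
  "matrix_inv long_run = (1 / \<sigma>\<^sup>2) *\<^sub>R
     matrix2 (\<omega>f\<^sup>2 + kQ\<^sup>2 * \<omega>v\<^sup>2) (kQ * \<omega>v\<^sup>2 - kP * \<omega>f\<^sup>2) (kQ * \<omega>v\<^sup>2 - kP * \<omega>f\<^sup>2) (\<omega>v\<^sup>2 + kP\<^sup>2 * \<omega>f\<^sup>2)"
  (is "_ = ?R")
proof -
  define m where "m = \<sigma>\<^sup>2 / \<Delta>\<^sup>2"
  define r where "r = 1 / \<sigma>\<^sup>2"
  have "m * r * \<Delta>\<^sup>2 = 1" using pos \<Delta>_pos by (simp add: m_def r_def)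
  then have mr: "m * r * (\<omega>f * \<omega>v * (1 + kP * kQ))\<^sup>2 = 1" by (simp only: \<Delta>_eq)
  have 1: "long_run ** ?R = mat 1"
    unfolding long_run_def m_def[symmetric] r_def[symmetric] matrix2_ops matrix2_eq_iff matrix2_nth
    using mr by (intro conjI) (algebra | simp add: algebra_simps)+
  have 2: "?R ** long_run = mat 1"
    unfolding long_run_def m_def[symmetric] r_def[symmetric] matrix2_ops matrix2_eq_iff matrix2_nth
    using mr by (intro conjI) (algebra | simp add: algebra_simps)+
  show "invertible long_run" using 1 2 unfolding invertible_def by blast
  show "matrix_inv long_run = ?R" using 1 2 by (rule matrix_inv_eqI)
qed

text \<open>Entrywise comparison shows that the two covariances can coincide only for equal
  bandwidths and equal gains with \<Delta> = 2 \<omega>f. This is the exception in the claim that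
  they are distinct.\<close>

lemma long_run_eq_cov_matrixD:
  assumes "long_run = cov_matrix"
  shows "\<omega>f = \<omega>v \<and> kP = kQ \<and> \<omega>f * (1 + kP\<^sup>2) = 2"
proof -
  have cancel: "2 * s * x = \<Delta> * y" if "\<sigma>\<^sup>2 / \<Delta>\<^sup>2 * x = \<sigma>\<^sup>2 / (2 * \<Delta> * s) * y" for x y
  proof -
    have "\<sigma>\<^sup>2 * \<Delta> * (2 * s * x) = (2 * s * \<Delta> ^ 3) * (\<sigma>\<^sup>2 / \<Delta>\<^sup>2 * x)"
      using \<Delta>_pos by (simp add: power3_eq_cube power2_eq_square)
    also have "\<dots> = (2 * s * \<Delta> ^ 3) * (\<sigma>\<^sup>2 / (2 * \<Delta> * s) * y)" by (simp only: that)
    also have "\<dots> = \<sigma>\<^sup>2 * \<Delta> * (\<Delta> * y)"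
      using \<Delta>_pos s_pos by (simp add: power3_eq_cube power2_eq_square)
    finally show ?thesis using pos \<Delta>_pos by simp
  qed
  have e: "2 * s * (\<omega>v\<^sup>2 + kP\<^sup>2 * \<omega>f\<^sup>2) = \<Delta> * (\<omega>v * s + kP\<^sup>2 * \<omega>f\<^sup>2 + kP * kQ * \<omega>f * \<omega>v)"
    "2 * s * (kP * \<omega>f\<^sup>2 - kQ * \<omega>v\<^sup>2) = \<Delta> * (kP * \<omega>f\<^sup>2 - kQ * \<omega>v\<^sup>2)"
    "2 * s * (\<omega>f\<^sup>2 + kQ\<^sup>2 * \<omega>v\<^sup>2) = \<Delta> * (\<omega>f * s + kQ\<^sup>2 * \<omega>v\<^sup>2 + kP * kQ * \<omega>f * \<omega>v)"
    using assms unfolding long_run_def cov_matrix_def matrix2_ops matrix2_eq_iff matrix2_nth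
    by (blast intro: cancel)+
  \<comment> \<open>A nonzero off-diagonal entry would force \<Delta> = 2 s, and the first diagonal
    equation would then make \<Delta>^2 vanish.\<close>
  have b: "kP * \<omega>f\<^sup>2 = kQ * \<omega>v\<^sup>2"
  proof (rule ccontr)
    assume "kP * \<omega>f\<^sup>2 \<noteq> kQ * \<omega>v\<^sup>2"
    then have "\<Delta> = 2 * s" using e(2) by simp
    then have "\<Delta> * (\<omega>v\<^sup>2 + kP\<^sup>2 * \<omega>f\<^sup>2) = \<Delta> * (\<omega>v * s + kP\<^sup>2 * \<omega>f\<^sup>2 + kP * kQ * \<omega>f * \<omega>v)"
      using e(1) by simp
    then have "\<Delta> * \<Delta> = 0" unfolding s_eq \<Delta>_eq by algebra
    then show False using \<Delta>_pos by simp
  qed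
  have k: "1 + kP * kQ > 0" using pos by (simp add: add_pos_nonneg)
  have "(s * (1 + kP * kQ) * \<omega>v) * (2 * \<omega>v - \<Delta>) = 0"
    using e(1) b unfolding s_eq by algebra
  then have v: "2 * \<omega>v = \<Delta>" using s_pos k pos by simp
  have "(s * (1 + kP * kQ) * \<omega>f) * (2 * \<omega>f - \<Delta>) = 0"
    using e(3) b unfolding s_eq by algebra
  then have f: "2 * \<omega>f = \<Delta>" using s_pos k pos by simp
  have eq: "\<omega>f = \<omega>v" using v f by simp
  have kk: "kP = kQ" using b pos by (simp add: eq)
  have "\<omega>v * (\<omega>f * (1 + kP\<^sup>2)) = \<omega>v * 2" using v unfolding \<Delta>_eq kk by (simp add: power2_eq_square mult_ac)
  then show ?thesis using eq kk pos by simp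
qed

lemma stationary_ou_long_run: "stationary_ou M F W A \<sigma> \<xi> \<Longrightarrow> long_run_cov M \<xi> = long_run"
  unfolding long_run_def by (simp only: stationary_ou_cov(4) long_run_formula)

text \<open>For gains of norm N < 1 every product of two gains is at most N, so each entry of either
  difference is O(N) with an explicit constant. The matrix norm is bounded by the sum of the
  absolute entries.\<close>

lemma long_run_asymptotics:
  assumes r: "norm (kP, kQ) < 1"
  shows "norm (long_run - \<sigma>\<^sup>2 *\<^sub>R matrix2 (1 / \<omega>f\<^sup>2) 0 0 (1 / \<omega>v\<^sup>2))
      \<le> 6 * (\<sigma>\<^sup>2 / (\<omega>f * \<omega>v)\<^sup>2) * (\<omega>f\<^sup>2 + \<omega>v\<^sup>2) * norm (kP, kQ)" (is ?A)
    and "norm (matrix_inv long_run - (1 / \<sigma>\<^sup>2) *\<^sub>R matrix2 (\<omega>f\<^sup>2) 0 0 (\<omega>v\<^sup>2))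
      \<le> 3 * (\<omega>f\<^sup>2 + \<omega>v\<^sup>2) / \<sigma>\<^sup>2 * norm (kP, kQ)" (is ?B)
proof -
  define N where "N = norm (kP, kQ)"
  have N: "kP \<le> N" "kQ \<le> N" "N < 1" "N \<ge> 0"
    using norm_fst_le[of kP kQ] norm_snd_le[of kQ kP] pos r by (simp_all add: N_def)
  have sq: "kP\<^sup>2 \<le> N" "kQ\<^sup>2 \<le> N" "kP * kQ \<le> N"
    using mult_mono[OF N(1) less_imp_le[OF order_le_less_trans[OF N(1,3)]]]
      mult_mono[OF N(2) less_imp_le[OF order_le_less_trans[OF N(2,3)]]]
      mult_mono[OF N(1) less_imp_le[OF order_le_less_trans[OF N(2,3)]]] pos N
    by (simp_all add: power2_eq_square)
  have off: "\<bar>kP * \<omega>f\<^sup>2 - kQ * \<omega>v\<^sup>2\<bar> \<le> N * (\<omega>f\<^sup>2 + \<omega>v\<^sup>2)"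
  proof -
    have "kP * \<omega>f\<^sup>2 \<le> N * \<omega>f\<^sup>2" "kQ * \<omega>v\<^sup>2 \<le> N * \<omega>v\<^sup>2" "0 \<le> kP * \<omega>f\<^sup>2" "0 \<le> kQ * \<omega>v\<^sup>2"
      using N pos by (auto intro: mult_right_mono)
    then show ?thesis unfolding abs_le_iff by (simp add: distrib_left)
  qed
  have d: "kP\<^sup>2 * \<omega>f\<^sup>2 \<le> N * \<omega>f\<^sup>2" "kQ\<^sup>2 * \<omega>v\<^sup>2 \<le> N * \<omega>v\<^sup>2"
    using sq by (auto intro: mult_right_mono)
  \<comment> \<open>The prefactor \<open>\<sigma>\<^sup>2 / \<Delta>\<^sup>2\<close> splits as
    \<open>m * k\<close>, where \<open>m\<close> is its value without coupling and \<open>k\<close>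
    carries the gains.\<close>
  define k where "k = 1 / (1 + kP * kQ)\<^sup>2"
  define m where "m = \<sigma>\<^sup>2 / (\<omega>f * \<omega>v)\<^sup>2"
  have m: "m \<ge> 0" by (simp add: m_def)
  have x: "0 \<le> kP * kQ" using pos by simp
  have k: "0 \<le> k" "k \<le> 1" "1 - k \<le> 3 * N"
  proof -
    let ?x = "kP * kQ"
    show "0 \<le> k" by (simp add: k_def)
    have "1 \<le> (1 + ?x)\<^sup>2" using x by (intro one_le_power) simp
    then show "k \<le> 1" unfolding k_def by (subst divide_le_eq_1) linarith
    have "1 - k = k * (2 * ?x + ?x\<^sup>2)"
    proof -
      have "k * (1 + ?x)\<^sup>2 = 1" using x by (simp add: k_def)
      then show ?thesis by (simp add: power2_eq_square algebra_simps)
    qed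
    also have "\<dots> \<le> 1 * (2 * ?x + ?x\<^sup>2)"
      using \<open>k \<le> 1\<close> x by (intro mult_right_mono) auto
    also have "?x\<^sup>2 \<le> ?x * 1"
      unfolding power2_eq_square using x sq(3) N by (intro mult_left_mono) auto
    finally show "1 - k \<le> 3 * N" using sq(3) by simp
  qed
  have L: "long_run = m *\<^sub>R matrix2 (k * (\<omega>v\<^sup>2 + kP\<^sup>2 * \<omega>f\<^sup>2)) (k * (kP * \<omega>f\<^sup>2 - kQ * \<omega>v\<^sup>2))
      (k * (kP * \<omega>f\<^sup>2 - kQ * \<omega>v\<^sup>2)) (k * (\<omega>f\<^sup>2 + kQ\<^sup>2 * \<omega>v\<^sup>2))"
  proof -
    have "\<sigma>\<^sup>2 / \<Delta>\<^sup>2 = m * k" by (simp add: m_def k_def \<Delta>_eq power_mult_distrib)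
    then show ?thesis unfolding long_run_def matrix2_ops by (simp add: mult.assoc)
  qed
  have L0: "\<sigma>\<^sup>2 *\<^sub>R matrix2 (1 / \<omega>f\<^sup>2) 0 0 (1 / \<omega>v\<^sup>2) = m *\<^sub>R matrix2 (\<omega>v\<^sup>2) 0 0 (\<omega>f\<^sup>2)"
    using pos by (simp add: matrix2_ops matrix2_eq_iff m_def power_mult_distrib)
  \<comment> \<open>The error splits into (k - 1) w, of size at most 3 N w, and k z, at most N
    y.\<close>
  have diag: "\<bar>k * (w + z) - w\<bar> \<le> N * (3 * w + y)" if "0 \<le> z" "z \<le> N * y" "0 \<le> w" for w z y
  proof -
    have "k * z \<le> z" "0 \<le> k * z" "(1 - k) * w \<le> 3 * N * w" "0 \<le> (1 - k) * w"
      using k that by (auto intro: mult_left_le_one_le mult_right_mono)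
    then show ?thesis using that by (simp add: abs_le_iff algebra_simps)
  qed
  have koff: "\<bar>k * (kP * \<omega>f\<^sup>2 - kQ * \<omega>v\<^sup>2)\<bar> \<le> N * (\<omega>f\<^sup>2 + \<omega>v\<^sup>2)"
  proof -
    have "\<bar>k * (kP * \<omega>f\<^sup>2 - kQ * \<omega>v\<^sup>2)\<bar> \<le> 1 * \<bar>kP * \<omega>f\<^sup>2 - kQ * \<omega>v\<^sup>2\<bar>"
      unfolding abs_mult using k by (intro mult_right_mono) auto
    then show ?thesis using off by simp
  qed
  have "norm (long_run - \<sigma>\<^sup>2 *\<^sub>R matrix2 (1 / \<omega>f\<^sup>2) 0 0 (1 / \<omega>v\<^sup>2))
     = m * norm (matrix2 (k * (\<omega>v\<^sup>2 + kP\<^sup>2 * \<omega>f\<^sup>2) - \<omega>v\<^sup>2) (k * (kP * \<omega>f\<^sup>2 - kQ * \<omega>v\<^sup>2) - 0)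
      (k * (kP * \<omega>f\<^sup>2 - kQ * \<omega>v\<^sup>2) - 0) (k * (\<omega>f\<^sup>2 + kQ\<^sup>2 * \<omega>v\<^sup>2) - \<omega>f\<^sup>2))"
    unfolding L L0 scaleR_diff_right[symmetric] matrix2_ops(3) using m by simp
  \<comment> \<open>The diagonal contributes 3 \<omega>v^2 + \<omega>f^2 and 3 \<omega>f^2 +
    \<omega>v^2, the off-diagonal entries \<omega>f^2 + \<omega>v^2 each; together this is the
    constant 6.\<close>
  also have "\<dots> \<le> m * (N * (3 * \<omega>v\<^sup>2 + \<omega>f\<^sup>2) + N * (\<omega>f\<^sup>2 + \<omega>v\<^sup>2) + N * (\<omega>f\<^sup>2 + \<omega>v\<^sup>2) + N * (3 * \<omega>f\<^sup>2 + \<omega>v\<^sup>2))"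
    using m koff d
    by (intro mult_left_mono order_trans[OF norm_matrix2_le] add_mono diag) simp_all
  also have "\<dots> = 6 * m * (\<omega>f\<^sup>2 + \<omega>v\<^sup>2) * N" by (simp add: algebra_simps)
  finally show ?A unfolding m_def N_def .
  have "norm (matrix_inv long_run - (1 / \<sigma>\<^sup>2) *\<^sub>R matrix2 (\<omega>f\<^sup>2) 0 0 (\<omega>v\<^sup>2))
     = 1 / \<sigma>\<^sup>2 * norm (matrix2 (kQ\<^sup>2 * \<omega>v\<^sup>2) (kQ * \<omega>v\<^sup>2 - kP * \<omega>f\<^sup>2) (kQ * \<omega>v\<^sup>2 - kP * \<omega>f\<^sup>2) (kP\<^sup>2 * \<omega>f\<^sup>2))"
    unfolding matrix_inv_long_run scaleR_diff_right[symmetric] matrix2_ops(3) by simp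
  also have "\<dots> \<le> 1 / \<sigma>\<^sup>2 * (N * \<omega>v\<^sup>2 + N * (\<omega>f\<^sup>2 + \<omega>v\<^sup>2) + N * (\<omega>f\<^sup>2 + \<omega>v\<^sup>2) + N * \<omega>f\<^sup>2)"
    using off d
    by (intro mult_left_mono order_trans[OF norm_matrix2_le] add_mono) (simp_all add: abs_minus_commute)
  also have "\<dots> = 3 * (\<omega>f\<^sup>2 + \<omega>v\<^sup>2) / \<sigma>\<^sup>2 * N" by (simp add: field_simps)
  finally show ?B unfolding N_def .
qed

end

text \<open>Leading order is made precise as a linear error bound in the norm of the gains, with
  \<open>C\<close> and \<delta> uniform over gains and processes. The general sign claim asks for a
  positive gain because the off-diagonal entry vanishes at zero coupling.\<close>

theorem theorem3p1:
  fixes \<omega>f \<omega>v kP kQ \<sigma> s \<Delta> :: real and A :: "real^2^2"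
  assumes pos: "\<omega>f > 0" "\<omega>v > 0" "kP \<ge> 0" "kQ \<ge> 0" "\<sigma> > 0"
    and A: "A = drift \<omega>f \<omega>v kP kQ"
    and s: "s = \<omega>f + \<omega>v"
    and \<Delta>: "\<Delta> = \<omega>f * \<omega>v * (1 + kP * kQ)"
  shows
    "hurwitz A
     \<comment> \<open>(a)\<close>
     \<and> (\<exists>!S. sym_pos_def S \<and> lyapunov A \<sigma> S)
     \<and> (\<forall>a b c. lyapunov A \<sigma> (matrix2 a b b c) \<longleftrightarrow>
           (vector [vector [- 2 * \<omega>f, 2 * kP * \<omega>f, 0],
                    vector [- kQ * \<omega>v, - s, kP * \<omega>f],
                    vector [0, - 2 * kQ * \<omega>v, - 2 * \<omega>v]] :: real^3^3) *v vector [a, b, c]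
             = vector [- \<sigma>\<^sup>2, 0, - \<sigma>\<^sup>2])
     \<and> inst_cov A \<sigma> = (\<sigma>\<^sup>2 / (2 * \<Delta> * s)) *\<^sub>R
           matrix2 (\<omega>v * s + kP\<^sup>2 * \<omega>f\<^sup>2 + kP * kQ * \<omega>f * \<omega>v) (kP * \<omega>f\<^sup>2 - kQ * \<omega>v\<^sup>2)
                   (kP * \<omega>f\<^sup>2 - kQ * \<omega>v\<^sup>2) (\<omega>f * s + kQ\<^sup>2 * \<omega>v\<^sup>2 + kP * kQ * \<omega>f * \<omega>v)
     \<and> inst_cov A \<sigma> $ 1 $ 2 = \<sigma>\<^sup>2 * (kP * \<omega>f\<^sup>2 - kQ * \<omega>v\<^sup>2) / (2 * \<Delta> * s)
     \<and> (kP = kQ \<and> kP > 0 \<and> \<omega>v > \<omega>f \<longrightarrow> inst_cov A \<sigma> $ 1 $ 2 < 0)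
     \<and> inst_cov (drift 10 20 (5 / 100) (5 / 100)) (2 / 100) $ 1 $ 2 < 0
     \<and> inst_cov (drift \<omega>f \<omega>v 0 0) \<sigma> = (\<sigma>\<^sup>2 / 2) *\<^sub>R matrix2 (1 / \<omega>f) 0 0 (1 / \<omega>v)
     \<and> (\<forall>(M::'a measure) F W \<xi>. stationary_ou M F W A \<sigma> \<xi> \<longrightarrow>
           (\<forall>t. square_integrable M (\<xi> t) \<and> cov M (\<xi> t) (\<xi> t) = inst_cov A \<sigma>))
     \<comment> \<open>(b)\<close>
     \<and> invertible (- A)
     \<and> (\<forall>(M::'a measure) F W \<xi>. stationary_ou M F W A \<sigma> \<xi> \<longrightarrow>
           integrable lborel (\<lambda>\<tau>. cov M (\<xi> 0) (\<xi> \<tau>))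
           \<and> long_run_cov M \<xi> =
               matrix_inv (- A) ** inst_cov A \<sigma> + inst_cov A \<sigma> ** transpose (matrix_inv (- A))
           \<and> invertible (long_run_cov M \<xi>)
           \<and> (\<not> (\<omega>f = \<omega>v \<and> kP = kQ \<and> \<omega>f * (1 + kP\<^sup>2) = 2) \<longrightarrow>
                 long_run_cov M \<xi> \<noteq> inst_cov A \<sigma>))
     \<and> (\<exists>C>0. \<exists>\<delta>>0. \<forall>p q. 0 \<le> p \<and> 0 \<le> q \<and> norm (p, q) < \<delta> \<longrightarrow>
           (\<forall>(M::'a measure) F W \<xi>. stationary_ou M F W (drift \<omega>f \<omega>v p q) \<sigma> \<xi> \<longrightarrow>
              norm (long_run_cov M \<xi> - \<sigma>\<^sup>2 *\<^sub>R matrix2 (1 / \<omega>f\<^sup>2) 0 0 (1 / \<omega>v\<^sup>2))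
                \<le> C * norm (p, q)
              \<and> norm (matrix_inv (long_run_cov M \<xi>)
                        - (1 / \<sigma>\<^sup>2) *\<^sub>R matrix2 (\<omega>f\<^sup>2) 0 0 (\<omega>v\<^sup>2))
                \<le> C * norm (p, q)))"
proof -
  interpret droop \<omega>f \<omega>v kP kQ \<sigma> s \<Delta>
    using pos s \<Delta> by unfold_locales
  note inst = inst_cov_eq[folded A]
  have off: "inst_cov A \<sigma> $ 1 $ 2 = \<sigma>\<^sup>2 * (kP * \<omega>f\<^sup>2 - kQ * \<omega>v\<^sup>2) / (2 * \<Delta> * s)"
    unfolding inst cov_matrix_def matrix2_ops by simp
  have hur: "hurwitz A" unfolding A using pos(1-4) by (rule hurwitz_drift)
  have ex1: "\<exists>!S. sym_pos_def S \<and> lyapunov A \<sigma> S" unfolding A by (rule ex1_lyapunov)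
  have system: "lyapunov A \<sigma> (matrix2 a b b c) \<longleftrightarrow>
           (vector [vector [- 2 * \<omega>f, 2 * kP * \<omega>f, 0],
                    vector [- kQ * \<omega>v, - s, kP * \<omega>f],
                    vector [0, - 2 * kQ * \<omega>v, - 2 * \<omega>v]] :: real^3^3) *v vector [a, b, c]
             = vector [- \<sigma>\<^sup>2, 0, - \<sigma>\<^sup>2]" for a b c
    unfolding A lyapunov_drift_iff s
    by (auto simp: vec_eq_iff forall_3 matrix_vector_mult_def sum_3 algebra_simps)
  have neg: "inst_cov A \<sigma> $ 1 $ 2 < 0" if "kP = kQ \<and> kP > 0 \<and> \<omega>v > \<omega>f"
  proof -
    have "\<omega>f\<^sup>2 < \<omega>v\<^sup>2" using that pos by (intro power_strict_mono) auto
    then have "kP * \<omega>f\<^sup>2 - kQ * \<omega>v\<^sup>2 < 0" using that by simp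
    then show ?thesis unfolding off using pos(5) s_pos \<Delta>_pos by (simp add: divide_less_0_iff mult_less_0_iff)
  qed
  have base: "inst_cov (drift 10 20 (5 / 100) (5 / 100)) (2 / 100) $ 1 $ 2 < 0"
  proof -
    interpret base: droop 10 20 "5 / 100" "5 / 100" "2 / 100" "10 + 20" "10 * 20 * (1 + 5 / 100 * (5 / 100))"
      by unfold_locales simp_all
    show ?thesis unfolding base.inst_cov_eq base.cov_matrix_def matrix2_ops matrix2_nth by simp
  qed
  have zero: "inst_cov (drift \<omega>f \<omega>v 0 0) \<sigma> = (\<sigma>\<^sup>2 / 2) *\<^sub>R matrix2 (1 / \<omega>f) 0 0 (1 / \<omega>v)"
  proof -
    interpret zero: droop \<omega>f \<omega>v 0 0 \<sigma> s "\<omega>f * \<omega>v * (1 + 0 * 0)"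
      using pos s by unfold_locales simp_all
    show ?thesis
      unfolding zero.inst_cov_eq zero.cov_matrix_def matrix2_ops matrix2_eq_iff matrix2_nth
      using pos s_pos by simp
  qed
  have asym: "\<exists>C>0. \<exists>\<delta>>0. \<forall>p q. 0 \<le> p \<and> 0 \<le> q \<and> norm (p, q) < \<delta> \<longrightarrow>
           (\<forall>(M::'a measure) F W \<xi>. stationary_ou M F W (drift \<omega>f \<omega>v p q) \<sigma> \<xi> \<longrightarrow>
              norm (long_run_cov M \<xi> - \<sigma>\<^sup>2 *\<^sub>R matrix2 (1 / \<omega>f\<^sup>2) 0 0 (1 / \<omega>v\<^sup>2))
                \<le> C * norm (p, q)
              \<and> norm (matrix_inv (long_run_cov M \<xi>)
                        - (1 / \<sigma>\<^sup>2) *\<^sub>R matrix2 (\<omega>f\<^sup>2) 0 0 (\<omega>v\<^sup>2))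
                \<le> C * norm (p, q))"
  proof -
    \<comment> \<open>The two estimates carry different constants, and their maximum serves both.
      The radius is 1 because both estimates hold for gains of norm below 1.\<close>
    let ?C1 = "6 * (\<sigma>\<^sup>2 / (\<omega>f * \<omega>v)\<^sup>2) * (\<omega>f\<^sup>2 + \<omega>v\<^sup>2)" and ?C2 = "3 * (\<omega>f\<^sup>2 + \<omega>v\<^sup>2) / \<sigma>\<^sup>2"
    have C: "?C1 > 0" "?C2 > 0" using pos by (simp_all add: add_pos_pos)
    have "norm (long_run_cov M \<xi> - \<sigma>\<^sup>2 *\<^sub>R matrix2 (1 / \<omega>f\<^sup>2) 0 0 (1 / \<omega>v\<^sup>2)) \<le> max ?C1 ?C2 * norm (p, q)
      \<and> norm (matrix_inv (long_run_cov M \<xi>) - (1 / \<sigma>\<^sup>2) *\<^sub>R matrix2 (\<omega>f\<^sup>2) 0 0 (\<omega>v\<^sup>2)) \<le> max ?C1 ?C2 * norm (p, q)"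
      if pq: "0 \<le> p" "0 \<le> q" "norm (p, q) < 1"
        and ou: "stationary_ou M F W (drift \<omega>f \<omega>v p q) \<sigma> \<xi>"
      for p q and M :: "'a measure" and F W \<xi>
    proof -
      interpret pq: droop \<omega>f \<omega>v p q \<sigma> s "\<omega>f * \<omega>v * (1 + p * q)"
        using pos s pq by unfold_locales simp_all
      have "?C1 * norm (p, q) \<le> max ?C1 ?C2 * norm (p, q)" "?C2 * norm (p, q) \<le> max ?C1 ?C2 * norm (p, q)"
        by (intro mult_right_mono max.cobounded1 max.cobounded2 norm_ge_zero)+
      then show ?thesis
        unfolding pq.stationary_ou_long_run[OF ou]
        using pq.long_run_asymptotics[OF pq(3)] by linarith
    qed
    then show ?thesis using C by (intro exI[of _ "max ?C1 ?C2"] conjI exI[of _ 1]) auto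
  qed
  have long: "integrable lborel (\<lambda>\<tau>. cov M (\<xi> 0) (\<xi> \<tau>))
           \<and> long_run_cov M \<xi> =
               matrix_inv (- A) ** inst_cov A \<sigma> + inst_cov A \<sigma> ** transpose (matrix_inv (- A))
           \<and> invertible (long_run_cov M \<xi>)
           \<and> (\<not> (\<omega>f = \<omega>v \<and> kP = kQ \<and> \<omega>f * (1 + kP\<^sup>2) = 2) \<longrightarrow> long_run_cov M \<xi> \<noteq> inst_cov A \<sigma>)"
    if "stationary_ou M F W A \<sigma> \<xi>" for M :: "'a measure" and F W \<xi>
    using stationary_ou_cov(3,4)[OF that[unfolded A]] stationary_ou_long_run[OF that[unfolded A]]
      matrix_inv_long_run(1) long_run_eq_cov_matrixD
    unfolding A inst_cov_eq matrix_inv_neg_drift by metis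
  have sq: "square_integrable M (\<xi> t) \<and> cov M (\<xi> t) (\<xi> t) = inst_cov A \<sigma>"
    if "stationary_ou M F W A \<sigma> \<xi>" for M :: "'a measure" and F W \<xi> t
    using stationary_ou_cov(1,2)[OF that[unfolded A]] unfolding A inst_cov_eq by blast
  have inv: "invertible (- A)" unfolding A by (rule invertible_neg_drift)
  show ?thesis
    by (intro conjI allI impI hur ex1 system inst[unfolded cov_matrix_def] off neg base zero inv asym)
      (blast dest: sq long)+
qed

end
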